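(* Let $T=(V,E)$ be a finite tree with at least one edge. Let $C\subseteq E$ be nonempty, suppose that $G_C$ is connected, and put $c=\lambda(C)$. Then $$\mathcal S_C(c)\ne\varnothing\quad\Longleftrightarrow\quad\lambda(A)>c\ \text{ for every }\varnothing\ne A\subsetneq C .$$ When these conditions hold, $\mathcal S_C(c)$ consists of one point. Consequently, if $w^*$ is an omega-limit point of a solution of the normalized inverse-weight Ricci flow on $T$ with positive initial metric, $C=E^+(w^* )$ (with $G_C$ not assumed connected), and $C_1,\ldots,C_s$ are the connected components of $G_C$, then $C$ and each $C_i$ attain the global minimum $c_*$ of $\lambda$ over the nonempty subsets of $E$. Moreover, each $C_i$ is inclusion-minimal among the minimizing sets.
   Context: $T=(V,E)$ is a finite tree with at least one edge; $d_x$ is the combinatorial degree of $x\in V$ and $E(x)$ the set of edges incident to $x$. A positive metric is $w=(w_e)_{e\in E}$ with all $w_e>0$; it induces the path metric $d_w$ on $V$. Put $D_x(w)=\sum_{e\ni x}1/w_e$. For $\alpha\in[0,1)$ let $m_x^\alpha(x)=\alpha$ and $m_x^\alpha(z)=(1-\alpha)\,w_{xz}^{-1}/D_x(w)$ for $z\sim x$. The (inverse-weight) Lin--Lu--Yau curvature of $e=xy$ is $\kappa_e(w)=\lim_{\alpha\uparrow1}\frac{1-W_1(m_x^\alpha,m_y^\alpha)/w_e}{1-\alpha}$, with $W_1$ the $1$-Wasserstein distance for $d_w$. Known formula on trees: $\kappa_{xy}(w)=\frac{2-d_x}{w_{xy}D_x(w)}+\frac{2-d_y}{w_{xy}D_y(w)}$.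 The normalized flow is $\dot w_e=-w_e(\kappa_e(w)-K(w))$, $K(w)=\sum_f w_f\kappa_f(w)$, with $w_e(0)>0$ and $\sum_e w_e(0)=1$ (this sum is preserved). For every positive initial metric the limits $c_e=\lim_{t\to\infty}\kappa_e(w(t))$ exist; put $c_*=\min_e c_e$. An omega-limit point of $w$ is a point $w^*\in\{q\in\mathbb R^E:q_e\ge0,\sum_e q_e=1\}$ such that $w(t_j)\to w^*$ for some sequence $t_j\to\infty$; its positive support is $E^+(w^* )=\{e\in E:w^*_e>0\}$. For $A\subseteq E$ set $\beta(A)=\sum_{x\in V,\,E(x)\subseteq A}(2-d_x)$ and, if $A\ne\varnothing$, $\lambda(A)=\beta(A)/|A|$. For nonempty $C\subseteq E$ let $\Delta_C=\{p\in\mathbb R^C:p_e>0\ \forall e\in C,\ \sum_{e\in C}p_e=1\}$. For $p\in\Delta_C$ and $e\in C$ put $$\kappa_e^C(p)=\sum_{x\in e,\ E(x)\subseteq C}\frac{2-d_x}{p_e\sum_{f\in E(x)}p_f^{-1}},$$ and for $c\in\mathbb R$ let $\mathcal S_C(c)=\{p\in\Delta_C:\kappa_e^C(p)=c\text{ for every }e\in C\}$. $G_C$ is the graph whose vertices are the edges in $C$, two of them being adjacent if they meet at a vertex $x$ with $d_x\ge3$ and $E(x)\subseteq C$. *)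

theory Defs
  imports "HOL-Analysis.Analysis"
begin

section \<open>Finite simple graphs and trees\<close>

text \<open>A graph is a vertex set together with a set of two-element sets of vertices.\<close>

definition simple_graph :: "'a set \<Rightarrow> 'a set set \<Rightarrow> bool" where
  "simple_graph V E \<longleftrightarrow> finite V \<and> (\<forall>e\<in>E. e \<subseteq> V \<and> card e = 2)"

definition walk :: "'a set \<Rightarrow> 'a set set \<Rightarrow> 'a list \<Rightarrow> bool" where
  "walk V E xs \<longleftrightarrow> xs \<noteq> [] \<and> set xs \<subseteq> V \<and> successively (\<lambda>x y. {x, y} \<in> E) xs"

definition walk_betw :: "'a set \<Rightarrow> 'a set set \<Rightarrow> 'a \<Rightarrow> 'a list \<Rightarrow> 'a \<Rightarrow> bool" where
  "walk_betw V E x xs y \<longleftrightarrow> walk V E xs \<and> hd xs = x \<and> last xs = y"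

definition graph_connected :: "'a set \<Rightarrow> 'a set set \<Rightarrow> bool" where
  "graph_connected V E \<longleftrightarrow> V \<noteq> {} \<and> (\<forall>x\<in>V. \<forall>y\<in>V. \<exists>xs. walk_betw V E x xs y)"

definition graph_components :: "'a set \<Rightarrow> 'a set set \<Rightarrow> 'a set set" where
  "graph_components V E = {{y\<in>V. \<exists>xs. walk_betw V E x xs y} | x. x \<in> V}"

text \<open>The first vertex of a cycle is repeated at the end of the list, so that length at least
  four means at least three edges.\<close>

definition graph_cycle :: "'a set \<Rightarrow> 'a set set \<Rightarrow> 'a list \<Rightarrow> bool" where
  "graph_cycle V E xs \<longleftrightarrow> walk V E xs \<and> 4 \<le> length xs \<and> hd xs = last xs \<and> distinct (tl xs)"

definition finite_tree :: "'a set \<Rightarrow> 'a set set \<Rightarrow> bool" where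
  "finite_tree V E \<longleftrightarrow>
     simple_graph V E \<and> graph_connected V E \<and> (\<nexists>xs. graph_cycle V E xs)"

definition edges_at :: "'a set set \<Rightarrow> 'a \<Rightarrow> 'a set set" where
  "edges_at E x = {e\<in>E. x \<in> e}"

definition degree :: "'a set set \<Rightarrow> 'a \<Rightarrow> nat" where
  "degree E x = card (edges_at E x)"

section \<open>Path metric, Wasserstein distance and Lin--Lu--Yau curvature\<close>

definition walk_length :: "('a set \<Rightarrow> real) \<Rightarrow> 'a list \<Rightarrow> real" where
  "walk_length w xs = (\<Sum>(x, y)\<leftarrow>zip xs (tl xs). w {x, y})"

definition path_metric :: "'a set \<Rightarrow> 'a set set \<Rightarrow> ('a set \<Rightarrow> real) \<Rightarrow> 'a \<Rightarrow> 'a \<Rightarrow> real" where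
  "path_metric V E w x y = Inf {walk_length w xs | xs. walk_betw V E x xs y}"

definition coupling :: "'a set \<Rightarrow> ('a \<Rightarrow> real) \<Rightarrow> ('a \<Rightarrow> real) \<Rightarrow> ('a \<Rightarrow> 'a \<Rightarrow> real) \<Rightarrow> bool" where
  "coupling V \<mu> \<nu> \<pi> \<longleftrightarrow>
     (\<forall>x\<in>V. \<forall>y\<in>V. 0 \<le> \<pi> x y) \<and>
     (\<forall>x\<in>V. (\<Sum>y\<in>V. \<pi> x y) = \<mu> x) \<and>
     (\<forall>y\<in>V. (\<Sum>x\<in>V. \<pi> x y) = \<nu> y)"

definition wasserstein1 ::
  "'a set \<Rightarrow> ('a \<Rightarrow> 'a \<Rightarrow> real) \<Rightarrow> ('a \<Rightarrow> real) \<Rightarrow> ('a \<Rightarrow> real) \<Rightarrow> real" where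
  "wasserstein1 V d \<mu> \<nu> = Inf {(\<Sum>x\<in>V. \<Sum>y\<in>V. \<pi> x y * d x y) | \<pi>. coupling V \<mu> \<nu> \<pi>}"

definition inv_weight_sum :: "'a set set \<Rightarrow> ('a set \<Rightarrow> real) \<Rightarrow> 'a \<Rightarrow> real" where
  "inv_weight_sum E w x = (\<Sum>e\<in>edges_at E x. 1 / w e)"

definition lazy_measure :: "'a set set \<Rightarrow> ('a set \<Rightarrow> real) \<Rightarrow> real \<Rightarrow> 'a \<Rightarrow> 'a \<Rightarrow> real" where
  "lazy_measure E w \<alpha> x z =
     (if z = x then \<alpha>
      else if {x, z} \<in> E then (1 - \<alpha>) * (1 / w {x, z}) / inv_weight_sum E w x
      else 0)"

definition lly_curvature :: "'a set \<Rightarrow> 'a set set \<Rightarrow> ('a set \<Rightarrow> real) \<Rightarrow> 'a \<Rightarrow> 'a \<Rightarrow> real" where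
  "lly_curvature V E w x y =
     Lim (at_left 1) (\<lambda>\<alpha>.
       (1 - wasserstein1 V (path_metric V E w) (lazy_measure E w \<alpha> x) (lazy_measure E w \<alpha> y)
              / w {x, y}) / (1 - \<alpha>))"

text \<open>The curvature is symmetric in the two endpoints, hence a function of the edge.\<close>

definition edge_curvature :: "'a set \<Rightarrow> 'a set set \<Rightarrow> ('a set \<Rightarrow> real) \<Rightarrow> 'a set \<Rightarrow> real" where
  "edge_curvature V E w e = (THE k. \<forall>x y. e = {x, y} \<longrightarrow> k = lly_curvature V E w x y)"

section \<open>The normalized flow\<close>

definition mean_curvature :: "'a set \<Rightarrow> 'a set set \<Rightarrow> ('a set \<Rightarrow> real) \<Rightarrow> real" where
  "mean_curvature V E w = (\<Sum>f\<in>E. w f * edge_curvature V E w f)"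

text \<open>The flow lives on positive metrics, the domain of the curvature. The derivative at time
  zero is one-sided.\<close>

definition normalized_flow :: "'a set \<Rightarrow> 'a set set \<Rightarrow> (real \<Rightarrow> 'a set \<Rightarrow> real) \<Rightarrow> bool" where
  "normalized_flow V E w \<longleftrightarrow>
     (\<Sum>e\<in>E. w 0 e) = 1 \<and>
     (\<forall>t\<ge>0. \<forall>e\<in>E. 0 < w t e) \<and>
     (\<forall>t\<ge>0. \<forall>e\<in>E.
        ((\<lambda>s. w s e) has_real_derivative
           - w t e * (edge_curvature V E (w t) e - mean_curvature V E (w t))) (at t within {0..}))"

definition limit_curvature ::
  "'a set \<Rightarrow> 'a set set \<Rightarrow> (real \<Rightarrow> 'a set \<Rightarrow> real) \<Rightarrow> 'a set \<Rightarrow> real" where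
  "limit_curvature V E w e = Lim at_top (\<lambda>t. edge_curvature V E (w t) e)"

definition min_limit_curvature :: "'a set \<Rightarrow> 'a set set \<Rightarrow> (real \<Rightarrow> 'a set \<Rightarrow> real) \<Rightarrow> real" where
  "min_limit_curvature V E w = Min (limit_curvature V E w ` E)"

text \<open>Vectors indexed by \<open>E\<close> are functions whose values outside \<open>E\<close> are irrelevant.\<close>

definition omega_limit_point ::
  "'a set set \<Rightarrow> (real \<Rightarrow> 'a set \<Rightarrow> real) \<Rightarrow> ('a set \<Rightarrow> real) \<Rightarrow> bool" where
  "omega_limit_point E w q \<longleftrightarrow>
     (\<forall>e\<in>E. 0 \<le> q e) \<and> (\<Sum>e\<in>E. q e) = 1 \<and>
     (\<exists>\<tau> :: nat \<Rightarrow> real. filterlim \<tau> at_top sequentially \<and>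
        (\<forall>e\<in>E. (\<lambda>j. w (\<tau> j) e) \<longlonglongrightarrow> q e))"

definition positive_support :: "'a set set \<Rightarrow> ('a set \<Rightarrow> real) \<Rightarrow> 'a set set" where
  "positive_support E q = {e\<in>E. 0 < q e}"

section \<open>The set function and the reduced system\<close>

definition beta :: "'a set \<Rightarrow> 'a set set \<Rightarrow> 'a set set \<Rightarrow> real" where
  "beta V E A = (\<Sum>x\<in>{x\<in>V. edges_at E x \<subseteq> A}. 2 - real (degree E x))"

definition lambda :: "'a set \<Rightarrow> 'a set set \<Rightarrow> 'a set set \<Rightarrow> real" where
  "lambda V E A = beta V E A / real (card A)"

definition lambda_min :: "'a set \<Rightarrow> 'a set set \<Rightarrow> real" where
  "lambda_min V E = Min (lambda V E ` {A. A \<noteq> {} \<and> A \<subseteq> E})"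

definition lambda_minimizers :: "'a set \<Rightarrow> 'a set set \<Rightarrow> 'a set set set" where
  "lambda_minimizers V E = {A. A \<noteq> {} \<and> A \<subseteq> E \<and> lambda V E A = lambda_min V E}"

text \<open>Points of the open simplex over \<open>C\<close> are extensional functions on \<open>C\<close>, so that
  counting solutions is meaningful.\<close>

definition open_simplex :: "'e set \<Rightarrow> ('e \<Rightarrow> real) set" where
  "open_simplex C = {p \<in> extensional C. (\<forall>e\<in>C. 0 < p e) \<and> (\<Sum>e\<in>C. p e) = 1}"

definition reduced_curvature ::
  "'a set set \<Rightarrow> 'a set set \<Rightarrow> ('a set \<Rightarrow> real) \<Rightarrow> 'a set \<Rightarrow> real" where
  "reduced_curvature E C p e =
     (\<Sum>x\<in>{x\<in>e. edges_at E x \<subseteq> C}.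
        (2 - real (degree E x)) / (p e * (\<Sum>f\<in>edges_at E x. 1 / p f)))"

definition reduced_solutions ::
  "'a set set \<Rightarrow> 'a set set \<Rightarrow> real \<Rightarrow> ('a set \<Rightarrow> real) set" where
  "reduced_solutions E C c =
     {p \<in> open_simplex C. \<forall>e\<in>C. reduced_curvature E C p e = c}"

text \<open>Edge set of the graph with vertex set \<open>C\<close>.\<close>

definition branch_adjacency :: "'a set \<Rightarrow> 'a set set \<Rightarrow> 'a set set \<Rightarrow> 'a set set set" where
  "branch_adjacency V E C =
     {{e, f} | e f. e \<in> C \<and> f \<in> C \<and> e \<noteq> f \<and>
        (\<exists>x\<in>V. x \<in> e \<and> x \<in> f \<and> 3 \<le> degree E x \<and> edges_at E x \<subseteq> C)}"

end

theory Submission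
  imports Defs
begin

text \<open>
  In the coordinates \<open>p e = exp (- y e)\<close> the reduced curvature is the gradient of the concave
  function \<open>G y = (\<Sum>x. (2 - degree x) * ln (\<Sum>f\<ni>x. exp (y f)))\<close>, the sum being over the vertices
  whose star lies in \<open>C\<close>. Summed over \<open>A \<subseteq> C\<close> it is at most \<open>beta A\<close>, with equality unless
  some star of degree at least three inside \<open>C\<close> meets both \<open>A\<close> and its complement. This gives the
  necessity of the inequalities, while the inequalities make \<open>G y - c * (\<Sum>e. y e)\<close> coercive modulo
  constants, so that it has a critical point; uniqueness is a maximum principle for the ratio of
  two solutions.

  An explicit coupling and a potential on the tree identify the Lin--Lu--Yau curvature with the
  reduced curvature for \<open>C = E\<close>. Up to a common shift, the flow is then the gradient flow of \<open>G\<close>,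
  along which concavity forces the velocities, that is the curvatures, to converge. Edges of
  larger limit curvature become infinitely shorter than those of minimal limit curvature \<open>m\<close>, hence
  the latter form a set with \<open>lambda = m\<close>, whereas \<open>lambda A \<ge> m\<close> always. The support \<open>C\<close> of an
  omega-limit point consists of edges of limit curvature \<open>m\<close>, and on it the reduced curvature is
  \<open>m\<close>; the equality case of the summed estimate settles the components of the graph on \<open>C\<close>.
\<close>

locale nontrivial_tree =
  fixes V :: "'a set" and E :: "'a set set"
  assumes tree: "finite_tree V E" and edges_nonempty: "E \<noteq> {}"
begin

section \<open>Walks and cuts\<close>

lemma finite_V: "finite V"
  using tree by (simp add: finite_tree_def simple_graph_def)

lemma edge_subset: "e \<in> E \<Longrightarrow> e \<subseteq> V"
  using tree by (simp add: finite_tree_def simple_graph_def)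

lemma card_edge: "e \<in> E \<Longrightarrow> card e = 2"
  using tree by (simp add: finite_tree_def simple_graph_def)

lemma finite_E: "finite E"
  using finite_V edge_subset by (meson PowI finite_Pow_iff finite_subset subsetI)

lemma finite_edge: "e \<in> E \<Longrightarrow> finite e"
  using finite_V edge_subset finite_subset by blast

lemma edge_ends: "{a, b} \<in> E \<Longrightarrow> a \<noteq> b"
  using card_edge[of "{a, b}"] by auto

lemma edge_obtain:
  assumes "e \<in> E"
  obtains a b where "e = {a, b}" "a \<noteq> b" "a \<in> V" "b \<in> V"
proof -
  obtain a b where "e = {a, b}" "a \<noteq> b"
    using card_edge[OF assms] by (auto simp: card_2_iff)
  then show ?thesis using edge_subset[OF assms] that by auto
qed

lemma edges_at_subset: "edges_at E x \<subseteq> E"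
  by (auto simp: edges_at_def)

lemma finite_edges_at: "finite (edges_at E x)"
  using finite_E edges_at_subset finite_subset by blast

lemma walk_exists: "x \<in> V \<Longrightarrow> y \<in> V \<Longrightarrow> \<exists>xs. walk_betw V E x xs y"
  using tree by (auto simp: finite_tree_def graph_connected_def)

lemma edges_at_nonempty:
  assumes "x \<in> V"
  shows "edges_at E x \<noteq> {}"
proof -
  obtain e where e: "e \<in> E" using edges_nonempty by auto
  obtain a b where ab: "e = {a, b}" "a \<noteq> b" "a \<in> V" "b \<in> V"
    using edge_obtain[OF e] by blast
  obtain y where y: "y \<in> V" "y \<noteq> x" using ab by auto
  obtain xs where xs: "walk_betw V E x xs y" using walk_exists[OF assms y(1)] by auto
  \<comment> \<open>\<open>remdups_adj.cases\<close> serves only as the split into empty, singleton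
    and longer lists.\<close>
  then obtain z zs where "xs = x # z # zs"
    using y by (cases xs rule: remdups_adj.cases) (auto simp: walk_betw_def walk_def)
  then have "{x, z} \<in> E" using xs by (auto simp: walk_betw_def walk_def)
  then show ?thesis by (auto simp: edges_at_def)
qed

lemma degree_pos: "x \<in> V \<Longrightarrow> 1 \<le> degree E x"
  using edges_at_nonempty finite_edges_at by (simp add: degree_def Suc_le_eq card_gt_0_iff)

end

lemma walk_betw_snoc:
  assumes "walk_betw V E x xs y" "z \<in> V" "{y, z} \<in> E"
  shows "walk_betw V E x (xs @ [z]) z"
  using assms by (auto simp: walk_betw_def walk_def successively_append_iff)

lemma walk_betw_refl: "x \<in> V \<Longrightarrow> walk_betw V E x [x] x"
  by (simp add: walk_betw_def walk_def)

text \<open>Loop removal: if the first vertex recurs in the simple walk already found for the tail,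
  that walk is cut back to the recurrence.\<close>

lemma walk_betw_distinct:
  assumes "walk_betw V E x xs y"
  shows "\<exists>ys. walk_betw V E x ys y \<and> distinct ys"
  using assms
proof (induction xs arbitrary: x)
  case Nil
  then show ?case by (simp add: walk_betw_def walk_def)
next
  case (Cons a xs)
  have a: "a = x" "x \<in> V" using Cons.prems by (auto simp: walk_betw_def walk_def)
  show ?case
  proof (cases "xs = []")
    case True
    then show ?thesis using Cons.prems by (intro exI[of _ "[x]"]) (auto simp: walk_betw_def walk_def)
  next
    case False
    then have tl: "walk_betw V E (hd xs) xs y" and e: "{x, hd xs} \<in> E"
      using Cons.prems a by (auto simp: walk_betw_def walk_def successively_Cons)
    obtain ys where ys: "walk_betw V E (hd xs) ys y" "distinct ys" using Cons.IH[OF tl] by auto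
    show ?thesis
    proof (cases "x \<in> set ys")
      case True
      then obtain us vs where "ys = us @ x # vs" by (auto dest: split_list)
      then have "walk_betw V E x (x # vs) y \<and> distinct (x # vs)"
        using ys by (auto simp: walk_betw_def walk_def successively_append_iff)
      then show ?thesis by blast
    next
      case False
      then have "walk_betw V E x (x # ys) y \<and> distinct (x # ys)"
        using ys e a by (auto simp: walk_betw_def walk_def successively_Cons)
      then show ?thesis by blast
    qed
  qed
qed

lemma successively_leaves_set:
  assumes "successively P xs" "xs \<noteq> []" "hd xs \<in> A" "last xs \<notin> A"
  shows "\<exists>x y. x \<in> A \<and> y \<notin> A \<and> x \<in> set xs \<and> y \<in> set xs \<and> P x y"
  using assms
proof (induction xs)
  case Nil
  then show ?case by simp
next
  case (Cons a xs)
  show ?case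
  proof (cases "hd xs \<in> A")
    case True
    then show ?thesis using Cons
      by (cases "xs = []") (auto simp: successively_Cons)
  next
    case False
    then show ?thesis using Cons.prems
      by (intro exI[of _ a] exI[of _ "hd xs"]) (cases "xs = []"; auto simp: successively_Cons)
  qed
qed

context nontrivial_tree
begin

text \<open>Every edge of a tree is a bridge. \<open>S\<close> is what \<open>a\<close> still
  reaches once the edge is deleted; a simple walk from \<open>a\<close> to \<open>b\<close> avoiding
  the edge would close up to a cycle.\<close>

lemma edge_cut:
  assumes "{a, b} \<in> E"
  shows "\<exists>S. a \<in> S \<and> b \<notin> S \<and> (\<forall>p q. {p, q} \<in> E \<longrightarrow> {p, q} \<noteq> {a, b} \<longrightarrow> (p \<in> S \<longleftrightarrow> q \<in> S))"
proof -
  define E' where "E' = E - {{a, b}}"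
  define S where "S = {v. \<exists>xs. walk_betw V E' a xs v}"
  have aV: "a \<in> V" "b \<in> V" and ab: "a \<noteq> b" using assms edge_subset edge_ends by auto
  have step: "q \<in> S" if "p \<in> S" "{p, q} \<in> E" "{p, q} \<noteq> {a, b}" for p q
  proof -
    have "{p, q} \<in> E'" "q \<in> V" using that edge_subset by (auto simp: E'_def)
    moreover obtain xs where "walk_betw V E' a xs p" using \<open>p \<in> S\<close> unfolding S_def by blast
    ultimately have "walk_betw V E' a (xs @ [q]) q" by (intro walk_betw_snoc)
    then show ?thesis unfolding S_def by blast
  qed
  have "b \<notin> S"
  proof
    assume "b \<in> S"
    then obtain xs where "walk_betw V E' a xs b" unfolding S_def by blast
    from walk_betw_distinct[OF this]
    obtain ys where ys: "walk_betw V E' a ys b" "distinct ys" by blast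
    have "graph_cycle V E (b # ys)"
      unfolding graph_cycle_def
    proof (intro conjI)
      have "successively (\<lambda>x y. {x, y} \<in> E) ys"
        using ys(1) unfolding walk_betw_def walk_def E'_def
        by (blast intro: successively_mono)
      moreover have "{b, a} \<in> E" using assms by (simp add: insert_commute)
      ultimately show "walk V E (b # ys)"
        using ys aV by (simp add: walk_betw_def walk_def successively_Cons)
      show "hd (b # ys) = last (b # ys)" using ys by (auto simp: walk_betw_def walk_def)
      show "distinct (tl (b # ys))" using ys by simp
      \<comment> \<open>The walk \<open>ys\<close> has a third vertex: its ends differ, and the edge
        that joins them directly has been deleted.\<close>
      show "4 \<le> length (b # ys)"
      proof (cases ys rule: remdups_adj.cases)
        case (3 p q zs)
        then have "zs \<noteq> []" using ys(1) by (auto simp: walk_betw_def walk_def E'_def)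
        then have "1 \<le> length zs" by (cases zs) auto
        then show ?thesis using 3 by simp
      next
        case 1
        then show ?thesis using ys by (simp add: walk_betw_def walk_def)
      next
        case (2 p)
        then show ?thesis using ys ab by (auto simp: walk_betw_def walk_def)
      qed
    qed
    then show False using tree by (auto simp: finite_tree_def)
  qed
  moreover have "a \<in> S" using walk_betw_refl[OF aV(1)] unfolding S_def by blast
  moreover have "p \<in> S \<longleftrightarrow> q \<in> S" if "{p, q} \<in> E" "{p, q} \<noteq> {a, b}" for p q
    using step[of p q] step[of q p] that by (metis insert_commute)
  ultimately show ?thesis by blast
qed

text \<open>Without cycles there is no obstruction to integrating an antisymmetric edge function.
  Instead of summing along paths, the potential adds up one signed cut indicator per edge.\<close>

lemma tree_potential:
  fixes g :: "'a \<Rightarrow> 'a \<Rightarrow> real"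
  assumes anti: "\<And>a b. {a, b} \<in> E \<Longrightarrow> g b a = - g a b"
  shows "\<exists>f. \<forall>a b. {a, b} \<in> E \<longrightarrow> f a - f b = g a b"
proof -
  define cut where "cut e a b S \<longleftrightarrow> e = {a, b} \<and> a \<in> S \<and> b \<notin> S \<and>
      (\<forall>p q. {p, q} \<in> E \<longrightarrow> {p, q} \<noteq> e \<longrightarrow> (p \<in> S \<longleftrightarrow> q \<in> S))" for e a b S
  have "\<exists>a b S. cut e a b S" if eE: "e \<in> E" for e
  proof -
    obtain a b where e: "e = {a, b}" using edge_obtain[OF eE] by metis
    show ?thesis using edge_cut[of a b] eE unfolding e cut_def by blast
  qed
  then obtain h t S where cut: "\<And>e. e \<in> E \<Longrightarrow> cut e (h e) (t e) (S e)"
    by metis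
  have S: "e = {h e, t e} \<and> h e \<in> S e \<and> t e \<notin> S e \<and>
      (\<forall>p q. {p, q} \<in> E \<longrightarrow> {p, q} \<noteq> e \<longrightarrow> (p \<in> S e \<longleftrightarrow> q \<in> S e))" if "e \<in> E" for e
    using cut[OF that] unfolding cut_def .
  \<comment> \<open>The indicator of \<open>S e\<close> jumps only across \<open>e\<close>, so along
    each edge exactly one summand changes.\<close>
  define f where "f u = (\<Sum>e\<in>E. g (h e) (t e) * of_bool (u \<in> S e))" for u
  have "f a - f b = g a b" if ab: "{a, b} \<in> E" for a b
  proof -
    have "f a - f b = (\<Sum>e\<in>E. g (h e) (t e) * (of_bool (a \<in> S e) - of_bool (b \<in> S e)))"
      by (simp add: f_def sum_subtractf right_diff_distrib)
    also have "\<dots> = (\<Sum>e\<in>E. if e = {a, b} then g a b else 0)"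
    proof (rule sum.cong)
      fix e assume e: "e \<in> E"
      show "g (h e) (t e) * (of_bool (a \<in> S e) - of_bool (b \<in> S e)) = (if e = {a, b} then g a b else 0)"
      proof (cases "e = {a, b}")
        case True
        then have "{h e, t e} = {a, b}" "h e \<in> S e" "t e \<notin> S e" using S[OF e] by auto
        then have "h e = a \<and> t e = b \<and> a \<in> S e \<and> b \<notin> S e \<or> h e = b \<and> t e = a \<and> b \<in> S e \<and> a \<notin> S e"
          by (metis doubleton_eq_iff)
        then show ?thesis using True anti[OF ab] by auto
      next
        case False
        then have "a \<in> S e \<longleftrightarrow> b \<in> S e" using S[OF e] ab by metis
        then show ?thesis using False by simp
      qed
    qed simp
    also have "\<dots> = g a b" using ab finite_E by simp
    finally show ?thesis .
  qed
  then show ?thesis by blast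
qed

end

section \<open>Transport of measures along a potential\<close>

lemma walk_length_simps [simp]:
  "walk_length w [x] = 0"
  "walk_length w (x # y # zs) = w {x, y} + walk_length w (y # zs)"
  by (simp_all add: walk_length_def)

lemma potential_le_walk_length:
  assumes "\<forall>a b. {a, b} \<in> E \<longrightarrow> f a - f b \<le> w {a, b}" "walk_betw V E x xs y"
  shows "f x - f y \<le> walk_length w xs"
  using assms(2)
proof (induction xs arbitrary: x rule: remdups_adj.induct)
  case (3 a b xs)
  then have "a = x" "{x, b} \<in> E" "walk_betw V E b (b # xs) y"
    by (auto simp: walk_betw_def walk_def)
  \<comment> \<open>The rule \<open>remdups_adj.induct\<close> states its induction hypothesis
    separately for equal and for distinct leading entries.\<close>
  moreover from this have "f b - f y \<le> walk_length w (b # xs)"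
    using 3 by (cases "a = b") auto
  ultimately show ?case using assms(1) by fastforce
qed (auto simp: walk_betw_def walk_def)

lemma walk_length_nonneg:
  assumes "\<forall>e\<in>E. 0 \<le> w e" "walk_betw V E x xs y"
  shows "0 \<le> walk_length w xs"
  using potential_le_walk_length[of E "\<lambda>_. 0" w V x xs y] assms by auto

lemma path_metric_le_walk_length:
  assumes "\<forall>e\<in>E. 0 \<le> w e" "walk_betw V E x xs y"
  shows "path_metric V E w x y \<le> walk_length w xs"
  unfolding path_metric_def using assms walk_length_nonneg[OF assms(1)]
  by (intro cInf_lower bdd_belowI[of _ 0]) auto

lemma sum_coupling_potential:
  fixes f :: "'a \<Rightarrow> real"
  assumes "coupling V \<mu> \<nu> \<pi>"
  shows "(\<Sum>u\<in>V. \<Sum>v\<in>V. \<pi> u v * (f u - f v)) = (\<Sum>u\<in>V. \<mu> u * f u) - (\<Sum>v\<in>V. \<nu> v * f v)"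
proof -
  have "(\<Sum>u\<in>V. \<Sum>v\<in>V. \<pi> u v * (f u - f v)) =
      (\<Sum>u\<in>V. \<Sum>v\<in>V. \<pi> u v * f u) - (\<Sum>u\<in>V. \<Sum>v\<in>V. \<pi> u v * f v)"
    by (simp add: right_diff_distrib sum_subtractf)
  also have "(\<Sum>u\<in>V. \<Sum>v\<in>V. \<pi> u v * f v) = (\<Sum>v\<in>V. \<Sum>u\<in>V. \<pi> u v * f v)"
    by (rule sum.swap)
  finally show ?thesis
    using assms by (simp add: coupling_def flip: sum_distrib_right)
qed

text \<open>Kantorovich duality with complementary slackness: a 1-Lipschitz potential bounds the
  cost of every coupling from below, and a coupling carried by tight pairs attains the
  bound.\<close>

lemma wasserstein1_eqI:
  assumes \<pi>: "coupling V \<mu> \<nu> \<pi>"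
    and lip: "\<And>u v. u \<in> V \<Longrightarrow> v \<in> V \<Longrightarrow> f u - f v \<le> d u v"
    and tight: "\<And>u v. u \<in> V \<Longrightarrow> v \<in> V \<Longrightarrow> \<pi> u v \<noteq> 0 \<Longrightarrow> d u v \<le> f u - f v"
  shows "wasserstein1 V d \<mu> \<nu> = (\<Sum>u\<in>V. \<mu> u * f u) - (\<Sum>v\<in>V. \<nu> v * f v)"
  unfolding wasserstein1_def
proof (rule cInf_eq_minimum)
  have "(\<Sum>u\<in>V. \<Sum>v\<in>V. \<pi> u v * d u v) = (\<Sum>u\<in>V. \<Sum>v\<in>V. \<pi> u v * (f u - f v))"
    using lip tight by (intro sum.cong refl) (metis antisym mult_zero_left)
  then show "(\<Sum>u\<in>V. \<mu> u * f u) - (\<Sum>v\<in>V. \<nu> v * f v)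
      \<in> {(\<Sum>x\<in>V. \<Sum>y\<in>V. \<pi> x y * d x y) |\<pi>. coupling V \<mu> \<nu> \<pi>}"
    using \<pi> sum_coupling_potential[OF \<pi>, of f] by force
next
  fix c assume "c \<in> {(\<Sum>x\<in>V. \<Sum>y\<in>V. \<pi> x y * d x y) |\<pi>. coupling V \<mu> \<nu> \<pi>}"
  then obtain \<rho> where \<rho>: "coupling V \<mu> \<nu> \<rho>" "c = (\<Sum>x\<in>V. \<Sum>y\<in>V. \<rho> x y * d x y)" by auto
  then show "(\<Sum>u\<in>V. \<mu> u * f u) - (\<Sum>v\<in>V. \<nu> v * f v) \<le> c"
    using lip unfolding sum_coupling_potential[OF \<rho>(1), symmetric] \<rho>(2)
    by (intro sum_mono mult_left_mono) (auto simp: coupling_def)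
qed

text \<open>Mass at a point where one measure is smaller stays put; the rest is coupled independently.\<close>

lemma coupling_with_fixed_mass:
  fixes \<mu> \<nu> :: "'a \<Rightarrow> real"
  assumes V: "finite V" "x \<in> V" "y \<in> V" "x \<noteq> y"
    and \<mu>: "\<And>u. 0 \<le> \<mu> u" "sum \<mu> V = 1" and \<nu>: "\<And>u. 0 \<le> \<nu> u" "sum \<nu> V = 1"
    and le: "\<mu> y \<le> \<nu> y" "\<nu> x \<le> \<mu> x" "\<mu> y + \<nu> x < 1"
  shows "\<exists>\<pi>. coupling V \<mu> \<nu> \<pi> \<and>
    (\<forall>u v. \<pi> u v \<noteq> 0 \<longrightarrow> u = v \<or> u \<noteq> y \<and> v \<noteq> x \<and> \<mu> u \<noteq> 0 \<and> \<nu> v \<noteq> 0)"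
proof -
  \<comment> \<open>The stationary mass is the smaller of the two measures at \<open>x\<close> and
    at \<open>y\<close>; the remaining mass \<open>M\<close> is positive, so the product of the two
    excesses can be divided by it.\<close>
  define r where "r u = (if u = x then \<nu> x else if u = y then \<mu> y else 0)" for u
  define M where "M = 1 - \<mu> y - \<nu> x"
  have M: "0 < M" using le by (simp add: M_def)
  have "sum r V = (\<Sum>u\<in>{x, y}. r u)"
    using V by (intro sum.mono_neutral_right) (auto simp: r_def)
  then have r: "sum r V = 1 - M" using V by (simp add: r_def M_def)
  have r\<mu>: "0 \<le> r u" "r u \<le> \<mu> u" "r u \<le> \<nu> u" for u
    using le \<mu> \<nu> by (auto simp: r_def)
  define \<pi> where "\<pi> u v = (if u = v then r u else 0) + (\<mu> u - r u) * (\<nu> v - r v) / M" for u v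
  have "coupling V \<mu> \<nu> \<pi>"
    unfolding coupling_def
  proof (intro conjI ballI)
    fix u v show "0 \<le> \<pi> u v" using r\<mu> M by (auto simp: \<pi>_def)
  next
    fix u assume u: "u \<in> V"
    have "(\<Sum>v\<in>V. \<pi> u v) = r u + (\<mu> u - r u) * (\<Sum>v\<in>V. \<nu> v - r v) / M"
      using u V(1) by (simp add: \<pi>_def sum.distrib sum_distrib_left sum_divide_distrib)
    then show "(\<Sum>v\<in>V. \<pi> u v) = \<mu> u" using r \<nu> M by (simp add: sum_subtractf)
  next
    fix v assume v: "v \<in> V"
    have "(\<Sum>u\<in>V. \<pi> u v) = r v + (\<Sum>u\<in>V. \<mu> u - r u) * (\<nu> v - r v) / M"
      using v V(1) by (simp add: \<pi>_def sum.distrib sum_distrib_right sum_divide_distrib)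
    then show "(\<Sum>u\<in>V. \<pi> u v) = \<nu> v" using r \<mu> M by (simp add: sum_subtractf)
  qed
  \<comment> \<open>Off the diagonal mass moves only between points of positive excess; the excess
    of the first measure vanishes at \<open>y\<close>, that of the second at
    \<open>x\<close>.\<close>
  moreover have "u \<noteq> y \<and> v \<noteq> x \<and> \<mu> u \<noteq> 0 \<and> \<nu> v \<noteq> 0" if "\<pi> u v \<noteq> 0" "u \<noteq> v" for u v
  proof -
    have "\<mu> u \<noteq> r u" "\<nu> v \<noteq> r v" using that by (auto simp: \<pi>_def)
    then show ?thesis using r\<mu>[of u] r\<mu>[of v] V by (auto simp: r_def)
  qed
  ultimately show ?thesis by blast
qed

section \<open>The Lin--Lu--Yau curvature of a tree\<close>

context nontrivial_tree
begin

lemma sum_edges_at: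
  "(\<Sum>e\<in>edges_at E x. F e) = (\<Sum>z\<in>{z\<in>V. {x, z} \<in> E}. F {x, z})"
proof -
  have "edges_at E x = (\<lambda>z. {x, z}) ` {z\<in>V. {x, z} \<in> E}"
  proof (intro equalityI subsetI)
    fix e assume "e \<in> edges_at E x"
    then have e: "e \<in> E" "x \<in> e" by (auto simp: edges_at_def)
    obtain a b where ab: "e = {a, b}" "a \<in> V" "b \<in> V" using edge_obtain[OF e(1)] by metis
    have "x = a \<or> x = b" using e ab by auto
    then have "e = {x, b} \<or> e = {x, a}" using ab(1) by (auto simp: insert_commute)
    then obtain z where "e = {x, z}" "z \<in> V" using ab(2,3) by blast
    then show "e \<in> (\<lambda>z. {x, z}) ` {z\<in>V. {x, z} \<in> E}" using e(1) by blast
  qed (auto simp: edges_at_def)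
  moreover have "inj_on (\<lambda>z. {x, z}) {z\<in>V. {x, z} \<in> E}"
    by (auto simp: inj_on_def doubleton_eq_iff)
  ultimately show ?thesis by (simp add: sum.reindex)
qed

lemma sum_lazy_measure:
  assumes "x \<in> V"
  shows "(\<Sum>u\<in>V. lazy_measure E w \<alpha> x u * h u) =
    \<alpha> * h x + (1 - \<alpha>) / inv_weight_sum E w x * (\<Sum>z\<in>{z\<in>V. {x, z} \<in> E}. h z / w {x, z})"
proof -
  have "(\<Sum>u\<in>V - {x}. lazy_measure E w \<alpha> x u * h u) =
      (\<Sum>z\<in>{z\<in>V. {x, z} \<in> E}. lazy_measure E w \<alpha> x z * h z)"
    using finite_V edge_ends by (intro sum.mono_neutral_right) (auto simp: lazy_measure_def)
  also have "\<dots> = (\<Sum>z\<in>{z\<in>V. {x, z} \<in> E}. (1 - \<alpha>) / inv_weight_sum E w x * (h z / w {x, z}))"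
    using edge_ends by (intro sum.cong) (auto simp: lazy_measure_def)
  finally show ?thesis
    using finite_V assms by (simp add: sum.remove[of V x] lazy_measure_def sum_distrib_left)
qed

lemma inv_weight_sum_pos:
  assumes "x \<in> V" "\<forall>e\<in>E. 0 < w e"
  shows "0 < inv_weight_sum E w x"
  unfolding inv_weight_sum_def using assms edges_at_nonempty finite_edges_at
  by (intro sum_pos) (auto simp: edges_at_def)

text \<open>The inverse weights cancel the edge lengths: each neighbour other than \<open>y\<close>
  contributes \<open>s\<close>, and \<open>y\<close> contributes \<open>- s\<close>, which gives
  \<open>degree - 2\<close> in total.\<close>

lemma sum_lazy_measure_potential:
  fixes f :: "'a \<Rightarrow> real"
  assumes xy: "{x, y} \<in> E" and w: "\<forall>e\<in>E. 0 < w e"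
    and fy: "f y - f x = - s * w {x, y}"
    and fz: "\<And>z. {x, z} \<in> E \<Longrightarrow> z \<noteq> y \<Longrightarrow> f z - f x = s * w {x, z}"
  shows "(\<Sum>u\<in>V. lazy_measure E w \<alpha> x u * f u) =
    f x + s * (1 - \<alpha>) * (real (degree E x) - 2) / inv_weight_sum E w x"
proof -
  let ?N = "{z\<in>V. {x, z} \<in> E}" and ?D = "inv_weight_sum E w x"
  have V: "x \<in> V" "y \<in> V" using xy edge_subset by auto
  have D: "0 < ?D" by (rule inv_weight_sum_pos[OF V(1) w])
  have "(\<Sum>z\<in>?N. (f z - f x) / w {x, z}) = (\<Sum>z\<in>?N. s - (if z = y then 2 * s else 0))"
  proof (rule sum.cong[OF refl])
    fix z assume z: "z \<in> ?N"
    then have "0 < w {x, z}" using w by auto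
    then show "(f z - f x) / w {x, z} = s - (if z = y then 2 * s else 0)"
      using fy fz[of z] z by auto
  qed
  also have "\<dots> = s * (real (card ?N) - 2)"
    using V xy finite_V by (simp add: sum_subtractf algebra_simps)
  also have "real (card ?N) = real (degree E x)"
    using sum_edges_at[of "\<lambda>_. 1::real" x] by (simp add: degree_def)
  finally have *: "(\<Sum>z\<in>?N. (f z - f x) / w {x, z}) = s * (real (degree E x) - 2)" .
  have "(\<Sum>z\<in>?N. f z / w {x, z}) = (\<Sum>z\<in>?N. (f z - f x) / w {x, z}) + f x * ?D"
    by (simp add: inv_weight_sum_def sum_edges_at sum_distrib_left diff_divide_distrib
        flip: sum.distrib)
  then have "(\<Sum>z\<in>?N. f z / w {x, z}) = s * (real (degree E x) - 2) + f x * ?D"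
    unfolding * .
  then show ?thesis
    unfolding sum_lazy_measure[OF V(1)] using D by (simp add: divide_simps) (simp add: algebra_simps)
qed

lemma lazy_measure_total:
  assumes "x \<in> V" "\<forall>e\<in>E. 0 < w e"
  shows "(\<Sum>u\<in>V. lazy_measure E w \<alpha> x u) = 1"
proof -
  have "(\<Sum>z\<in>{z\<in>V. {x, z} \<in> E}. 1 / w {x, z}) = inv_weight_sum E w x"
    by (simp add: inv_weight_sum_def sum_edges_at)
  then show ?thesis
    using sum_lazy_measure[OF assms(1), of w \<alpha> "\<lambda>_. 1"] inv_weight_sum_pos[OF assms] by simp
qed

lemma lazy_measure_nonneg:
  assumes "x \<in> V" "\<forall>e\<in>E. 0 < w e" "0 \<le> \<alpha>" "\<alpha> \<le> 1"
  shows "0 \<le> lazy_measure E w \<alpha> x u"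
  using assms(2-4) inv_weight_sum_pos[OF assms(1,2)]
  by (auto simp: lazy_measure_def)

text \<open>For laziness above one half each endpoint of an edge receives less than one half from
  the other measure, as \<open>coupling_with_fixed_mass\<close> demands.\<close>

lemma lazy_measure_le:
  assumes "x \<in> V" "\<forall>e\<in>E. 0 < w e" "\<alpha> \<le> 1" "u \<noteq> x"
  shows "lazy_measure E w \<alpha> x u \<le> 1 - \<alpha>"
proof (cases "{x, u} \<in> E")
  case True
  then have "1 / w {x, u} \<le> inv_weight_sum E w x"
    unfolding inv_weight_sum_def using assms(2) finite_edges_at
    by (intro member_le_sum) (auto simp: edges_at_def less_imp_le)
  then have "(1 - \<alpha>) * (1 / w {x, u}) \<le> (1 - \<alpha>) * inv_weight_sum E w x"
    using assms by (intro mult_left_mono) auto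
  then show ?thesis using True assms inv_weight_sum_pos[OF assms(1,2)]
    by (simp add: lazy_measure_def divide_simps mult_ac)
qed (use assms in \<open>simp add: lazy_measure_def\<close>)

text \<open>All moving mass travels from the side of \<open>x\<close> through the edge to the side
  of \<open>y\<close>. A potential that descends at unit slope along such routes certifies that the
  coupling is optimal.\<close>

lemma wasserstein1_lazy_measure:
  assumes xy: "{x, y} \<in> E" and w: "\<forall>e\<in>E. 0 < w e" and \<alpha>: "1/2 < \<alpha>" "\<alpha> < 1"
  shows "wasserstein1 V (path_metric V E w) (lazy_measure E w \<alpha> x) (lazy_measure E w \<alpha> y) =
    w {x, y} + (1 - \<alpha>) * ((real (degree E x) - 2) / inv_weight_sum E w x +
      (real (degree E y) - 2) / inv_weight_sum E w y)"
proof -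
  have V: "x \<in> V" "y \<in> V" and ne: "x \<noteq> y" using xy edge_subset edge_ends by auto
  have yx: "{y, x} \<in> E" using xy by (simp add: insert_commute)
  \<comment> \<open>Prescribed slope: 1 for steps into \<open>x\<close> from outside, from
    \<open>x\<close> to \<open>y\<close>, and out of \<open>y\<close>; -1 for the reversed steps; 0
    on edges away from both endpoints.\<close>
  define s :: "'a \<Rightarrow> 'a \<Rightarrow> real" where "s a b =
    (if b = x \<and> a \<noteq> y \<or> a = y \<and> b \<noteq> x \<or> a = x \<and> b = y then 1
     else if a = x \<and> b \<noteq> y \<or> b = y \<and> a \<noteq> x \<or> b = x \<and> a = y then -1 else 0)" for a b
  have "\<exists>f. \<forall>a b. {a, b} \<in> E \<longrightarrow> f a - f b = s a b * w {a, b}"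
  proof (rule tree_potential)
    fix a b assume "{a, b} \<in> E"
    then have "a \<noteq> b" by (rule edge_ends)
    then have "s b a = - s a b" using ne by (auto simp: s_def)
    then show "s b a * w {b, a} = - (s a b * w {a, b})" by (simp add: insert_commute)
  qed
  then obtain f where f: "\<And>a b. {a, b} \<in> E \<Longrightarrow> f a - f b = s a b * w {a, b}" by blast
  have fxy: "f x - f y = w {x, y}" using f[OF xy] ne by (simp add: s_def)
  have fzx: "f z - f x = w {z, x}" if "{z, x} \<in> E" "z \<noteq> y" for z
    using f[OF that(1)] that ne by (simp add: s_def)
  have fyz: "f y - f z = w {y, z}" if "{y, z} \<in> E" "z \<noteq> x" for z
    using f[OF that(1)] that ne by (simp add: s_def)
  have lip: "\<forall>a b. {a, b} \<in> E \<longrightarrow> f a - f b \<le> w {a, b}"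
    using f w by (force simp: s_def)
  let ?\<mu> = "lazy_measure E w \<alpha> x" and ?\<nu> = "lazy_measure E w \<alpha> y"
  have "\<exists>\<pi>. coupling V ?\<mu> ?\<nu> \<pi> \<and>
      (\<forall>u v. \<pi> u v \<noteq> 0 \<longrightarrow> u = v \<or> u \<noteq> y \<and> v \<noteq> x \<and> ?\<mu> u \<noteq> 0 \<and> ?\<nu> v \<noteq> 0)"
  proof (rule coupling_with_fixed_mass[OF finite_V V ne])
    show "?\<mu> y \<le> ?\<nu> y" "?\<nu> x \<le> ?\<mu> x" "?\<mu> y + ?\<nu> x < 1"
      using lazy_measure_le[of x w \<alpha> y] lazy_measure_le[of y w \<alpha> x] V w \<alpha> ne
      by (auto simp: lazy_measure_def[of E w \<alpha> x x] lazy_measure_def[of E w \<alpha> y y])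
  qed (use V w \<alpha> in \<open>auto intro: lazy_measure_nonneg lazy_measure_total\<close>)
  then obtain \<pi> where \<pi>: "coupling V ?\<mu> ?\<nu> \<pi>"
    and supp: "\<And>u v. \<pi> u v \<noteq> 0 \<Longrightarrow> u = v \<or> u \<noteq> y \<and> v \<noteq> x \<and> ?\<mu> u \<noteq> 0 \<and> ?\<nu> v \<noteq> 0"
    by blast
  have wn: "\<forall>e\<in>E. 0 \<le> w e" using w by (simp add: less_imp_le)
  have "wasserstein1 V (path_metric V E w) ?\<mu> ?\<nu> = (\<Sum>u\<in>V. ?\<mu> u * f u) - (\<Sum>v\<in>V. ?\<nu> v * f v)"
  proof (rule wasserstein1_eqI[OF \<pi>])
    fix u v assume uv: "u \<in> V" "v \<in> V"
    show "f u - f v \<le> path_metric V E w u v"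
      unfolding path_metric_def using walk_exists[OF uv] potential_le_walk_length[OF lip]
      by (intro cInf_greatest) auto
    assume "\<pi> u v \<noteq> 0"
    then consider "u = v" | "u \<noteq> y" "v \<noteq> x" "?\<mu> u \<noteq> 0" "?\<nu> v \<noteq> 0"
      using supp by blast
    then show "path_metric V E w u v \<le> f u - f v"
    proof cases
      case 1
      then show ?thesis
        using path_metric_le_walk_length[OF wn walk_betw_refl[OF uv(1)]] by simp
    next
      case 2
      then have u: "u = x \<or> {u, x} \<in> E" and v: "v = y \<or> {y, v} \<in> E"
        by (auto simp: lazy_measure_def insert_commute split: if_splits)
      \<comment> \<open>The route from \<open>u\<close> through \<open>x\<close> and
        \<open>y\<close> to \<open>v\<close>, without repeating a vertex when \<open>u = x\<close>
        or \<open>v = y\<close>. Its length equals the drop of \<open>f\<close>.\<close>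
      define xs where "xs = (if u = x then [x] else [u, x]) @ (if v = y then [y] else [y, v])"
      have "walk_betw V E u xs v"
        using u v uv V xy by (auto simp: xs_def walk_betw_def walk_def)
      then have "path_metric V E w u v \<le> walk_length w xs"
        by (rule path_metric_le_walk_length[OF wn])
      also have "\<dots> = f u - f v"
        using u v 2 fxy fzx[of u] fyz[of v] by (auto simp: xs_def)
      finally show ?thesis .
    qed
  qed
  also have "(\<Sum>u\<in>V. ?\<mu> u * f u) =
      f x + 1 * (1 - \<alpha>) * (real (degree E x) - 2) / inv_weight_sum E w x"
    \<comment> \<open>Seen from \<open>x\<close> the outer neighbours lie higher, so the sign is 1;
      seen from \<open>y\<close> they lie lower, and the sign below is -1.\<close>
    using fxy fzx by (intro sum_lazy_measure_potential[OF xy w]) (auto simp: insert_commute)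
  also have "(\<Sum>u\<in>V. ?\<nu> u * f u) =
      f y + (- 1) * (1 - \<alpha>) * (real (degree E y) - 2) / inv_weight_sum E w y"
  proof (rule sum_lazy_measure_potential[OF yx w])
    show "f x - f y = - (- 1) * w {y, x}" using fxy by (simp add: insert_commute)
    show "f z - f y = - 1 * w {y, z}" if "{y, z} \<in> E" "z \<noteq> x" for z
      using fyz[OF that] by simp
  qed
  finally show ?thesis
    using fxy by (simp add: diff_divide_distrib add_divide_distrib algebra_simps)
qed

text \<open>For laziness strictly between one half and one the difference quotient is already
  constant, so the one-sided limit is immediate.\<close>

lemma lly_curvature_eq:
  assumes xy: "{x, y} \<in> E" and w: "\<forall>e\<in>E. 0 < w e"
  shows "lly_curvature V E w x y =
    (2 - real (degree E x)) / (w {x, y} * inv_weight_sum E w x) +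
    (2 - real (degree E y)) / (w {x, y} * inv_weight_sum E w y)"
    (is "_ = ?k")
  unfolding lly_curvature_def
proof (rule tendsto_Lim)
  have V: "x \<in> V" "y \<in> V" using xy edge_subset by auto
  have pos: "0 < w {x, y}" "0 < inv_weight_sum E w x" "0 < inv_weight_sum E w y"
    using bspec[OF w xy] V inv_weight_sum_pos w by auto
  have "(1 - wasserstein1 V (path_metric V E w) (lazy_measure E w \<alpha> x) (lazy_measure E w \<alpha> y)
      / w {x, y}) / (1 - \<alpha>) = ?k" if "\<alpha> \<in> {1/2<..<1}" for \<alpha>
    using that pos by (simp add: wasserstein1_lazy_measure[OF xy w] field_simps)
  moreover have "\<forall>\<^sub>F \<alpha> in at_left 1. \<alpha> \<in> {1/2<..<1::real}"
    by (rule eventually_at_leftI[of "1/2"]) auto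
  ultimately show "((\<lambda>\<alpha>. (1 - wasserstein1 V (path_metric V E w)
      (lazy_measure E w \<alpha> x) (lazy_measure E w \<alpha> y) / w {x, y}) / (1 - \<alpha>)) \<longlongrightarrow> ?k) (at_left 1)"
    by (intro tendsto_eventually) (auto elim: eventually_mono)
qed simp

text \<open>The formula is symmetric in the endpoints, so the definite description in
  \<open>edge_curvature\<close> denotes. For \<open>C = E\<close> no vertex is excluded from the
  reduced sum.\<close>

lemma edge_curvature_eq_reduced:
  assumes e: "e \<in> E" and w: "\<forall>e\<in>E. 0 < w e"
  shows "edge_curvature V E w e = reduced_curvature E E w e"
proof -
  obtain a b where ab: "e = {a, b}" "a \<noteq> b" using edge_obtain[OF e] by metis
  have k: "lly_curvature V E w x y = reduced_curvature E E w e" if "e = {x, y}" for x y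
  proof -
    have "{x, y} \<in> E" using that e by simp
    moreover have "{z \<in> e. edges_at E z \<subseteq> E} = {x, y}" "x \<noteq> y"
      using edges_at_subset that edge_ends e by auto
    ultimately show ?thesis
      using lly_curvature_eq[OF _ w] that
      by (simp add: reduced_curvature_def inv_weight_sum_def)
  qed
  show ?thesis
    unfolding edge_curvature_def using k ab by (intro the_equality) auto
qed

end

section \<open>The reduced curvature\<close>

definition inner_vertices :: "'a set \<Rightarrow> 'a set set \<Rightarrow> 'a set set \<Rightarrow> 'a set" where
  "inner_vertices V E C = {x\<in>V. edges_at E x \<subseteq> C}"

text \<open>The probability that the inverse-weight random walk leaves \<open>x\<close> through
  \<open>e\<close>. Extension by zero off the star allows sums over edges and vertices to be
  exchanged.\<close>

definition share :: "'a set set \<Rightarrow> ('a set \<Rightarrow> real) \<Rightarrow> 'a \<Rightarrow> 'a set \<Rightarrow> real" where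
  "share E p x e = (if x \<in> e then 1 / (p e * (\<Sum>f\<in>edges_at E x. 1 / p f)) else 0)"

text \<open>These vertices make the summed estimate strict: a star of degree one cannot be split,
  and at degree two the coefficient vanishes.\<close>

definition crossing :: "'a set \<Rightarrow> 'a set set \<Rightarrow> 'a set set \<Rightarrow> 'a set set \<Rightarrow> 'a \<Rightarrow> bool" where
  "crossing V E C A x \<longleftrightarrow> x \<in> inner_vertices V E C \<and> 3 \<le> degree E x \<and>
     edges_at E x \<inter> A \<noteq> {} \<and> \<not> edges_at E x \<subseteq> A"

context nontrivial_tree
begin

lemma finite_inner_vertices: "finite (inner_vertices V E C)"
  using finite_V by (simp add: inner_vertices_def)

lemma reduced_curvature_eq_sum_share:
  assumes "e \<in> E"
  shows "reduced_curvature E C p e =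
    (\<Sum>x\<in>inner_vertices V E C. (2 - real (degree E x)) * share E p x e)"
proof -
  have "(\<Sum>x\<in>inner_vertices V E C. (2 - real (degree E x)) * share E p x e) =
    (\<Sum>x\<in>{x\<in>e. edges_at E x \<subseteq> C}. (2 - real (degree E x)) * share E p x e)"
    using edge_subset[OF assms] finite_inner_vertices
    by (intro sum.mono_neutral_right) (auto simp: inner_vertices_def share_def)
  also have "\<dots> = reduced_curvature E C p e"
    unfolding reduced_curvature_def by (intro sum.cong) (auto simp: share_def)
  finally show ?thesis ..
qed

lemma sum_inverse_pos:
  assumes "x \<in> V" "\<forall>e\<in>edges_at E x. 0 < p e"
  shows "0 < (\<Sum>e\<in>edges_at E x. 1 / p e :: real)"
  using assms edges_at_nonempty finite_edges_at by (intro sum_pos) auto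

lemma share_pos:
  assumes "x \<in> V" "\<forall>e\<in>edges_at E x. 0 < p e" "e \<in> edges_at E x"
  shows "0 < share E p x e"
  using assms sum_inverse_pos[OF assms(1,2)] by (simp add: share_def edges_at_def)

lemma share_nonneg:
  assumes "x \<in> V" "\<forall>e\<in>edges_at E x. 0 < p e" "e \<in> E"
  shows "0 \<le> share E p x e"
  using share_pos[OF assms(1,2), of e] assms(3) by (cases "x \<in> e") (auto simp: edges_at_def share_def)

lemma sum_share:
  assumes "x \<in> V" "\<forall>e\<in>edges_at E x. 0 < p e"
  shows "(\<Sum>e\<in>edges_at E x. share E p x e) = 1"
proof -
  have "(\<Sum>e\<in>edges_at E x. share E p x e) =
      (\<Sum>e\<in>edges_at E x. 1 / p e) / (\<Sum>f\<in>edges_at E x. 1 / p f)"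
    unfolding sum_divide_distrib by (intro sum.cong) (auto simp: share_def edges_at_def)
  then show ?thesis using sum_inverse_pos[OF assms] by simp
qed

lemma sum_share_Int:
  assumes "A \<subseteq> E"
  shows "(\<Sum>e\<in>A. share E p x e) = (\<Sum>e\<in>A \<inter> edges_at E x. share E p x e)"
  using assms finite_E finite_subset
  by (intro sum.mono_neutral_right) (auto simp: share_def edges_at_def)

lemma sum_share_superset:
  assumes "x \<in> V" "\<forall>e\<in>edges_at E x. 0 < p e" "A \<subseteq> E" "edges_at E x \<subseteq> A"
  shows "(\<Sum>e\<in>A. share E p x e) = 1"
  using sum_share[OF assms(1,2)] sum_share_Int[OF assms(3), of p x] assms(4)
  by (simp add: Int_absorb1)

lemma sum_reduced_curvature:
  assumes "A \<subseteq> E"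
  shows "(\<Sum>e\<in>A. reduced_curvature E C p e) =
    (\<Sum>x\<in>inner_vertices V E C. (2 - real (degree E x)) * (\<Sum>e\<in>A. share E p x e))"
proof -
  have "(\<Sum>e\<in>A. reduced_curvature E C p e) =
      (\<Sum>e\<in>A. \<Sum>x\<in>inner_vertices V E C. (2 - real (degree E x)) * share E p x e)"
    using assms by (intro sum.cong) (auto simp: reduced_curvature_eq_sum_share)
  also have "\<dots> = (\<Sum>x\<in>inner_vertices V E C. \<Sum>e\<in>A. (2 - real (degree E x)) * share E p x e)"
    by (rule sum.swap)
  finally show ?thesis by (simp add: sum_distrib_left)
qed

lemma beta_eq_sum_inner:
  assumes "A \<subseteq> C"
  shows "beta V E A =
    (\<Sum>x\<in>inner_vertices V E C. if edges_at E x \<subseteq> A then 2 - real (degree E x) else 0)"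
  unfolding beta_def using assms finite_V
  by (subst sum.inter_filter[symmetric])
     (auto simp: inner_vertices_def intro!: sum.cong)

lemma degree_1_edges_at:
  assumes "x \<in> V" "degree E x = 1"
  shows "\<exists>e. edges_at E x = {e}"
  using assms by (auto simp: degree_def card_1_singleton_iff)

text \<open>Either the star lies in \<open>A\<close> and its shares add up to one, or it misses
  \<open>A\<close>, or the degree is two and both sides vanish.\<close>

lemma star_term_eq:
  assumes x: "x \<in> inner_vertices V E C" and p: "\<forall>e\<in>C. 0 < p e" and A: "A \<subseteq> E"
    and nc: "\<not> crossing V E C A x"
  shows "(2 - real (degree E x)) * (\<Sum>e\<in>A. share E p x e) =
    (if edges_at E x \<subseteq> A then 2 - real (degree E x) else 0)"
proof -
  have xV: "x \<in> V" and px: "\<forall>e\<in>edges_at E x. 0 < p e"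
    using x p by (auto simp: inner_vertices_def)
  note ne = edges_at_nonempty[OF xV]
  consider "edges_at E x \<subseteq> A" | "edges_at E x \<inter> A = {}" | "degree E x = 2"
  proof -
    have "degree E x \<ge> 1" using degree_pos[OF xV] .
    moreover have "edges_at E x \<subseteq> A \<or> edges_at E x \<inter> A = {}" if "degree E x = 1"
      using degree_1_edges_at[OF xV that] by auto
    ultimately show ?thesis
      using that nc x unfolding crossing_def by (cases "degree E x = 1") force+
  qed
  then show ?thesis
  proof cases
    case 1
    then show ?thesis using sum_share_superset[OF xV px A] by simp
  next
    case 2
    then show ?thesis using sum_share_Int[OF A, of p x] ne by (auto simp: Int_commute)
  qed simp
qed

text \<open>The coefficient is negative and \<open>A\<close> receives a positive share, while the
  right-hand side is zero.\<close>

lemma star_term_less: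
  assumes p: "\<forall>e\<in>C. 0 < p e" and A: "A \<subseteq> E" and c: "crossing V E C A x"
  shows "(2 - real (degree E x)) * (\<Sum>e\<in>A. share E p x e) <
    (if edges_at E x \<subseteq> A then 2 - real (degree E x) else 0)"
proof -
  have xV: "x \<in> V" and px: "\<forall>e\<in>edges_at E x. 0 < p e"
    using c p by (auto simp: inner_vertices_def crossing_def)
  have "0 < (\<Sum>e\<in>A \<inter> edges_at E x. share E p x e)"
    using share_pos[OF xV px] c finite_edges_at
    by (intro sum_pos) (auto simp: crossing_def)
  then show ?thesis
    using c unfolding sum_share_Int[OF A] by (simp add: crossing_def mult_less_0_iff)
qed

lemma star_term_le:
  assumes "x \<in> inner_vertices V E C" "\<forall>e\<in>C. 0 < p e" "A \<subseteq> E"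
  shows "(2 - real (degree E x)) * (\<Sum>e\<in>A. share E p x e) \<le>
    (if edges_at E x \<subseteq> A then 2 - real (degree E x) else 0)"
  using star_term_eq[OF assms] star_term_less[OF assms(2,3), of x] less_imp_le order_refl
  by (metis (full_types))

lemma sum_reduced_curvature_eq_beta:
  assumes "A \<subseteq> C" "C \<subseteq> E" "\<forall>e\<in>C. 0 < p e" "\<nexists>x. crossing V E C A x"
  shows "(\<Sum>e\<in>A. reduced_curvature E C p e) = beta V E A"
  unfolding sum_reduced_curvature[OF order_trans[OF assms(1,2)]] beta_eq_sum_inner[OF assms(1)]
  using assms by (intro sum.cong refl star_term_eq) auto

lemma sum_reduced_curvature_le_beta:
  assumes "A \<subseteq> C" "C \<subseteq> E" "\<forall>e\<in>C. 0 < p e"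
  shows "(\<Sum>e\<in>A. reduced_curvature E C p e) \<le> beta V E A"
  unfolding sum_reduced_curvature[OF order_trans[OF assms(1,2)]] beta_eq_sum_inner[OF assms(1)]
  using assms by (intro sum_mono star_term_le) auto

lemma sum_reduced_curvature_less_beta:
  assumes "A \<subseteq> C" "C \<subseteq> E" "\<forall>e\<in>C. 0 < p e" "crossing V E C A x"
  shows "(\<Sum>e\<in>A. reduced_curvature E C p e) < beta V E A"
  unfolding sum_reduced_curvature[OF order_trans[OF assms(1,2)]] beta_eq_sum_inner[OF assms(1)]
proof (rule sum_strict_mono_ex1[OF finite_inner_vertices], intro ballI star_term_le)
  show "\<exists>x\<in>inner_vertices V E C. (2 - real (degree E x)) * (\<Sum>e\<in>A. share E p x e) <
      (if edges_at E x \<subseteq> A then 2 - real (degree E x) else 0)"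
    using star_term_less[OF assms(3) order_trans[OF assms(1,2)] assms(4)] assms(4)
    by (intro bexI[of _ x]) (auto simp only: crossing_def)
qed (use assms in auto)

text \<open>The walk makes some step from \<open>A\<close> to its complement; the branch vertex that
  causes this adjacency has both edges in its star.\<close>

lemma crossing_if_walk_leaves:
  assumes "C \<subseteq> E" "walk_betw C (branch_adjacency V E C) a xs b" "a \<in> A" "b \<notin> A"
  shows "\<exists>x. crossing V E C A x"
proof -
  have "\<exists>e f. e \<in> A \<and> f \<notin> A \<and> e \<in> set xs \<and> f \<in> set xs \<and> {e, f} \<in> branch_adjacency V E C"
    using assms by (intro successively_leaves_set) (auto simp: walk_betw_def walk_def)
  then obtain e f where ef: "e \<in> A" "f \<notin> A" "{e, f} \<in> branch_adjacency V E C" by blast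
  from ef(3) obtain g h x where gh: "{e, f} = {g, h}" "x \<in> V" "x \<in> g" "x \<in> h"
      "3 \<le> degree E x" "edges_at E x \<subseteq> C" "g \<in> C" "h \<in> C"
    unfolding branch_adjacency_def by blast
  then have "e \<in> C \<and> f \<in> C \<and> x \<in> e \<and> x \<in> f" by (auto simp: doubleton_eq_iff)
  then have "e \<in> edges_at E x" "f \<in> edges_at E x" using assms(1) by (auto simp: edges_at_def)
  then have "crossing V E C A x" using gh ef by (auto simp: crossing_def inner_vertices_def)
  then show ?thesis ..
qed

lemma crossing_if_connected:
  assumes "graph_connected C (branch_adjacency V E C)" "C \<subseteq> E" "A \<noteq> {}" "A \<subset> C"
  shows "\<exists>x. crossing V E C A x"
proof -
  obtain a b where ab: "a \<in> A" "b \<in> C" "b \<notin> A" "a \<in> C" using assms by blast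
  then obtain xs where "walk_betw C (branch_adjacency V E C) a xs b"
    using assms(1) unfolding graph_connected_def by blast
  then show ?thesis using crossing_if_walk_leaves[OF assms(2)] ab by blast
qed

lemma lambda_iff_beta:
  assumes "A \<subseteq> E" "A \<noteq> {}"
  shows "c < lambda V E A \<longleftrightarrow> c * real (card A) < beta V E A"
    and "c \<le> lambda V E A \<longleftrightarrow> c * real (card A) \<le> beta V E A"
    and "lambda V E A = c \<longleftrightarrow> beta V E A = c * real (card A)"
proof -
  have "0 < card A" using assms finite_E finite_subset card_gt_0_iff by blast
  then show "c < lambda V E A \<longleftrightarrow> c * real (card A) < beta V E A"
    and "c \<le> lambda V E A \<longleftrightarrow> c * real (card A) \<le> beta V E A"
    and "lambda V E A = c \<longleftrightarrow> beta V E A = c * real (card A)"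
    by (simp_all add: lambda_def field_simps)
qed

text \<open>A solution has summed curvature \<open>c * card A\<close> over \<open>A\<close>, and a
  crossing vertex keeps this strictly below \<open>beta V E A\<close>.\<close>

lemma lambda_greater_if_solution:
  assumes C: "C \<subseteq> E" and p: "p \<in> reduced_solutions E C c"
    and A: "A \<noteq> {}" "A \<subset> C" and x: "crossing V E C A x"
  shows "c < lambda V E A"
proof -
  have "(\<Sum>e\<in>A. reduced_curvature E C p e) = (\<Sum>e\<in>A. c)"
    using p A by (intro sum.cong) (auto simp: reduced_solutions_def)
  moreover have "(\<Sum>e\<in>A. reduced_curvature E C p e) < beta V E A"
    using p A C x
    by (intro sum_reduced_curvature_less_beta) (auto simp: reduced_solutions_def open_simplex_def)
  ultimately show ?thesis using lambda_iff_beta(1)[of A c] A C by (simp add: mult.commute)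
qed

text \<open>Maximum principle for the ratio of two solutions: on the set of edges where \<open>p / q\<close> is
  maximal every share of \<open>p\<close> is at most the share of \<open>q\<close>.\<close>

lemma reduced_solutions_unique:
  assumes C: "C \<subseteq> E" "C \<noteq> {}" and conn: "graph_connected C (branch_adjacency V E C)"
    and p: "p \<in> reduced_solutions E C c" and q: "q \<in> reduced_solutions E C c"
  shows "p = q"
proof -
  have finC: "finite C" using C finite_E finite_subset by blast
  have pp: "\<forall>e\<in>C. 0 < p e" and qp: "\<forall>e\<in>C. 0 < q e"
    and sums: "sum p C = 1" "sum q C = 1" and ext: "p \<in> extensional C" "q \<in> extensional C"
    using p q by (auto simp: reduced_solutions_def open_simplex_def)
  define r where "r = Max ((\<lambda>e. p e / q e) ` C)"
  define A where "A = {e\<in>C. p e / q e = r}"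
  have r: "p e / q e \<le> r" if "e \<in> C" for e
    using that finC by (simp add: r_def)
  have "r \<in> (\<lambda>e. p e / q e) ` C" unfolding r_def using finC C by (intro Max_in) auto
  then have "A \<noteq> {}" by (auto simp: A_def)
  have share: "share E p x e \<le> share E q x e \<and> (\<not> edges_at E x \<subseteq> A \<longrightarrow> share E p x e < share E q x e)"
    if e: "e \<in> A" "x \<in> e" "x \<in> inner_vertices V E C" for e x
  proof -
    have eC: "e \<in> C" and x: "x \<in> V" "edges_at E x \<subseteq> C" using e by (auto simp: A_def inner_vertices_def)
    then have "e \<in> edges_at E x" using e C by (auto simp: edges_at_def)
    have pos: "0 < p f" "0 < q f" if "f \<in> C" for f using that pp qp by auto
    have le: "q e / q f \<le> p e / p f" "p f / q f \<noteq> r \<Longrightarrow> q e / q f < p e / p f" if "f \<in> C" for f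
    proof -
      have "p f / q f \<le> p e / q e" using r[OF that] e by (simp add: A_def)
      then show "q e / q f \<le> p e / p f" using pos[OF that] pos[OF eC] by (simp add: field_simps)
      assume "p f / q f \<noteq> r"
      then have "p f / q f < p e / q e" using r[OF that] e by (simp add: A_def)
      then show "q e / q f < p e / p f" using pos[OF that] pos[OF eC] by (simp add: field_simps)
    qed
    have q0: "0 < (\<Sum>f\<in>edges_at E x. q e / q f)"
      using \<open>e \<in> edges_at E x\<close> x pos eC finite_edges_at by (intro sum_pos) auto
    have 1: "(\<Sum>f\<in>edges_at E x. q e / q f) \<le> (\<Sum>f\<in>edges_at E x. p e / p f)"
      using le x by (intro sum_mono) auto
    have 2: "(\<Sum>f\<in>edges_at E x. q e / q f) < (\<Sum>f\<in>edges_at E x. p e / p f)"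
      if nA: "\<not> edges_at E x \<subseteq> A"
    proof (rule sum_strict_mono_ex1[OF finite_edges_at])
      show "\<forall>f\<in>edges_at E x. q e / q f \<le> p e / p f" using le(1) x by auto
      obtain f where "f \<in> edges_at E x" "f \<notin> A" using nA by auto
      then show "\<exists>f\<in>edges_at E x. q e / q f < p e / p f"
        using le(2)[of f] x by (auto simp: A_def)
    qed
    \<comment> \<open>In this form a share depends only on ratios of weights, which is what
      maximality of \<open>p e / q e\<close> controls.\<close>
    have eq: "share E v x e = 1 / (\<Sum>f\<in>edges_at E x. v e / v f)" for v
      using e(2) by (simp add: share_def sum_distrib_left)
    show ?thesis
      unfolding eq using q0 1 2 by (intro conjI impI frac_le frac_less2) simp_all
  qed
  \<comment> \<open>At a crossing vertex an edge of \<open>A\<close> has a strictly smaller share of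
    \<open>p\<close> than of \<open>q\<close>, with a negative coefficient. Its curvature would be
    strictly larger for \<open>p\<close>, yet both equal \<open>c\<close>.\<close>
  have nc: "\<not> crossing V E C A z" for z
  proof
    assume z: "crossing V E C A z"
    then obtain e where e: "e \<in> A" "e \<in> edges_at E z" by (auto simp: crossing_def)
    have eE: "e \<in> E" "z \<in> e" using e by (auto simp: edges_at_def)
    have mono: "(2 - real (degree E x)) * share E q x e \<le> (2 - real (degree E x)) * share E p x e"
      if x: "x \<in> inner_vertices V E C" for x
    proof (cases "x \<in> e")
      case True
      \<comment> \<open>At a leaf the coefficient is positive and would reverse the inequality, but
        there both shares equal one.\<close>
      show ?thesis
      proof (cases "degree E x = 1")
        case True
        then obtain g where "edges_at E x = {g}"
          using degree_1_edges_at[of x] x unfolding inner_vertices_def by blast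
        moreover have "e \<in> edges_at E x" using eE \<open>x \<in> e\<close> by (auto simp: edges_at_def)
        ultimately have "edges_at E x = {e}" by auto
        moreover have "e \<in> C" using e(1) by (simp add: A_def)
        then have "0 < p e" "0 < q e" using pp qp by auto
        ultimately show ?thesis by (simp add: share_def)
      next
        case False
        moreover have "1 \<le> degree E x" using x degree_pos by (auto simp: inner_vertices_def)
        ultimately show ?thesis
          using share[OF e(1) \<open>x \<in> e\<close> x] by (intro mult_left_mono_neg) auto
      qed
    qed (simp add: share_def)
    have "reduced_curvature E C q e < reduced_curvature E C p e"
      unfolding reduced_curvature_eq_sum_share[OF eE(1)]
    proof (rule sum_strict_mono_ex1[OF finite_inner_vertices], intro ballI mono)
      have "(2 - real (degree E z)) * share E q z e < (2 - real (degree E z)) * share E p z e"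
        using share[OF e(1) eE(2)] z by (intro mult_strict_left_mono_neg) (auto simp: crossing_def)
      then show "\<exists>x\<in>inner_vertices V E C.
          (2 - real (degree E x)) * share E q x e < (2 - real (degree E x)) * share E p x e"
        using z by (auto simp only: crossing_def)
    qed
    moreover have "e \<in> C" using e by (auto simp: A_def)
    ultimately show False using p q by (auto simp: reduced_solutions_def)
  qed
  have "A = C"
    using crossing_if_connected[OF conn C(1) \<open>A \<noteq> {}\<close>] nc by (auto simp: A_def)
  have pr: "p e = r * q e" if "e \<in> C" for e
  proof -
    have "p e / q e = r" "0 < q e" using that \<open>A = C\<close> qp by (auto simp: A_def)
    then show ?thesis by (simp add: field_simps)
  qed
  then have "sum p C = r * sum q C" by (simp add: sum_distrib_left)
  then have "r = 1" using sums by simp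
  then show ?thesis using pr ext by (intro extensionalityI[of _ C]) auto
qed

end

section \<open>The concave potential of the reduced system\<close>

definition star_potential :: "'a set \<Rightarrow> 'a set set \<Rightarrow> 'a set set \<Rightarrow> ('a set \<Rightarrow> real) \<Rightarrow> real" where
  "star_potential V E C y = (\<Sum>x\<in>inner_vertices V E C.
     (2 - real (degree E x)) * ln (\<Sum>f\<in>edges_at E x. exp (y f)))"

text \<open>The recession function of \<open>star_potential\<close>: under large scaling each
  log-sum-exp becomes a maximum.\<close>

definition star_max :: "'a set \<Rightarrow> 'a set set \<Rightarrow> 'a set set \<Rightarrow> ('a set \<Rightarrow> real) \<Rightarrow> real" where
  "star_max V E C y = (\<Sum>x\<in>inner_vertices V E C.
     (2 - real (degree E x)) * Max (y ` edges_at E x))"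

text \<open>Convexity of log-sum-exp. With \<open>m\<close> the weighted mean of
  \<open>b - a\<close>, the bound \<open>1 + u <= exp u\<close> is applied to the centred
  differences, whose weighted sum is zero.\<close>

lemma log_sum_exp_ge_tangent:
  fixes a b :: "'e \<Rightarrow> real"
  assumes "finite S" "S \<noteq> {}"
  shows "ln (\<Sum>f\<in>S. exp (a f)) + (\<Sum>f\<in>S. exp (a f) * (b f - a f)) / (\<Sum>f\<in>S. exp (a f))
    \<le> ln (\<Sum>f\<in>S. exp (b f))"
proof -
  let ?Z = "\<Sum>f\<in>S. exp (a f)"
  define m where "m = (\<Sum>f\<in>S. exp (a f) * (b f - a f)) / ?Z"
  have Z: "0 < ?Z" using assms by (intro sum_pos) auto
  have "(\<Sum>f\<in>S. exp (a f) * (1 + (b f - a f - m))) =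
      ?Z + (\<Sum>f\<in>S. exp (a f) * (b f - a f)) - m * ?Z"
    by (simp add: algebra_simps sum.distrib sum_subtractf sum_distrib_left)
  also have "\<dots> = ?Z" using Z by (simp add: m_def)
  finally have "?Z = (\<Sum>f\<in>S. exp (a f) * (1 + (b f - a f - m)))" ..
  also have "\<dots> \<le> (\<Sum>f\<in>S. exp (a f) * exp (b f - a f - m))"
    by (intro sum_mono mult_left_mono exp_ge_add_one_self) auto
  also have "\<dots> = exp (- m) * (\<Sum>f\<in>S. exp (b f))"
    by (simp add: sum_distrib_left flip: exp_add)
  finally have "exp m * ?Z \<le> (\<Sum>f\<in>S. exp (b f))"
    by (simp add: exp_minus field_simps)
  then have "ln (exp m * ?Z) \<le> ln (\<Sum>f\<in>S. exp (b f))"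
    using Z by (intro ln_mono) auto
  then show ?thesis using Z by (simp add: ln_mult m_def)
qed

context nontrivial_tree
begin

lemma share_exp:
  "x \<in> e \<Longrightarrow> share E (\<lambda>e. exp (- y e)) x e = exp (y e) / (\<Sum>f\<in>edges_at E x. exp (y f))"
  by (simp add: share_def exp_minus divide_simps)

lemma sum_share_exp:
  "(\<Sum>e\<in>edges_at E x. share E (\<lambda>e. exp (- y e)) x e * v e) =
    (\<Sum>f\<in>edges_at E x. exp (y f) * v f) / (\<Sum>f\<in>edges_at E x. exp (y f))"
  unfolding sum_divide_distrib by (intro sum.cong) (auto simp: share_exp edges_at_def)

lemma sum_weighted_reduced_curvature:
  assumes "C \<subseteq> E"
  shows "(\<Sum>e\<in>C. reduced_curvature E C p e * v e) = (\<Sum>x\<in>inner_vertices V E C.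
    (2 - real (degree E x)) * (\<Sum>e\<in>edges_at E x. share E p x e * v e))"
proof -
  have "(\<Sum>e\<in>C. reduced_curvature E C p e * v e) =
      (\<Sum>e\<in>C. \<Sum>x\<in>inner_vertices V E C. (2 - real (degree E x)) * (share E p x e * v e))"
    using assms
    by (intro sum.cong) (auto simp: reduced_curvature_eq_sum_share sum_distrib_right mult.assoc)
  also have "\<dots> = (\<Sum>x\<in>inner_vertices V E C. \<Sum>e\<in>C. (2 - real (degree E x)) * (share E p x e * v e))"
    by (rule sum.swap)
  also have "\<dots> = (\<Sum>x\<in>inner_vertices V E C.
      \<Sum>e\<in>edges_at E x. (2 - real (degree E x)) * (share E p x e * v e))"
    using assms finite_E finite_subset
    by (intro sum.cong refl sum.mono_neutral_right)
       (auto simp: inner_vertices_def share_def edges_at_def)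
  finally show ?thesis by (simp add: sum_distrib_left)
qed

lemma sum_exp_pos:
  "x \<in> inner_vertices V E C \<Longrightarrow> 0 < (\<Sum>f\<in>edges_at E x. exp (y f :: real))"
  using edges_at_nonempty finite_edges_at by (intro sum_pos) (auto simp: inner_vertices_def)

lemma star_potential_has_derivative:
  assumes C: "C \<subseteq> E"
    and Y: "\<And>e. e \<in> C \<Longrightarrow> ((\<lambda>t. Y t e) has_real_derivative Y' e) (at t within S)"
  shows "((\<lambda>t. star_potential V E C (Y t)) has_real_derivative
    (\<Sum>e\<in>C. reduced_curvature E C (\<lambda>e. exp (- Y t e)) e * Y' e)) (at t within S)"
  unfolding star_potential_def sum_weighted_reduced_curvature[OF C] sum_share_exp
proof (intro DERIV_sum DERIV_cmult)
  fix x assume x: "x \<in> inner_vertices V E C"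
  have Z: "((\<lambda>t. \<Sum>f\<in>edges_at E x. exp (Y t f)) has_real_derivative
      (\<Sum>f\<in>edges_at E x. exp (Y t f) * Y' f)) (at t within S)"
    using x Y by (auto intro!: derivative_eq_intros simp: inner_vertices_def subset_iff)
  show "((\<lambda>t. ln (\<Sum>f\<in>edges_at E x. exp (Y t f))) has_real_derivative
      (\<Sum>f\<in>edges_at E x. exp (Y t f) * Y' f) / (\<Sum>f\<in>edges_at E x. exp (Y t f))) (at t within S)"
    using DERIV_chain2[OF DERIV_ln_divide[OF sum_exp_pos[OF x]] Z] by simp
qed

text \<open>Concavity: from degree two on, a nonpositive coefficient multiplies a convex function;
  at a leaf the coefficient is positive but the logarithm is linear.\<close>

lemma star_potential_le_tangent:
  assumes C: "C \<subseteq> E"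
  shows "star_potential V E C b \<le> star_potential V E C a +
    (\<Sum>e\<in>C. reduced_curvature E C (\<lambda>e. exp (- a e)) e * (b e - a e))"
  unfolding star_potential_def sum_weighted_reduced_curvature[OF C] sum_share_exp sum.distrib[symmetric]
    distrib_left[symmetric]
proof (rule sum_mono)
  fix x assume "x \<in> inner_vertices V E C"
  then have x: "x \<in> V" by (simp add: inner_vertices_def)
  show "(2 - real (degree E x)) * ln (\<Sum>f\<in>edges_at E x. exp (b f)) \<le>
    (2 - real (degree E x)) * (ln (\<Sum>f\<in>edges_at E x. exp (a f)) +
      (\<Sum>f\<in>edges_at E x. exp (a f) * (b f - a f)) / (\<Sum>f\<in>edges_at E x. exp (a f)))"
  proof (cases "degree E x = 1")
    case True
    then obtain e where "edges_at E x = {e}" using degree_1_edges_at x by blast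
    then show ?thesis by simp
  next
    case False
    then have "2 - real (degree E x) \<le> 0" using degree_pos[OF x] by linarith
    then show ?thesis
      using log_sum_exp_ge_tangent[OF finite_edges_at edges_at_nonempty[OF x]]
      by (intro mult_left_mono_neg)
  qed
qed

text \<open>Log-sum-exp dominates the maximum and nonpositive coefficients reverse this; at a leaf
  the two coincide.\<close>

lemma star_potential_le_star_max: "star_potential V E C y \<le> star_max V E C y"
  unfolding star_potential_def star_max_def
proof (rule sum_mono)
  fix x assume "x \<in> inner_vertices V E C"
  then have x: "x \<in> V" by (simp add: inner_vertices_def)
  note [simp] = finite_edges_at
  show "(2 - real (degree E x)) * ln (\<Sum>f\<in>edges_at E x. exp (y f)) \<le>
    (2 - real (degree E x)) * Max (y ` edges_at E x)"
  proof (cases "degree E x = 1")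
    case True
    then obtain e where "edges_at E x = {e}" using degree_1_edges_at x by blast
    then show ?thesis by simp
  next
    case False
    then have d: "2 - real (degree E x) \<le> 0" using degree_pos[OF x] by linarith
    have "Max (y ` edges_at E x) \<in> y ` edges_at E x"
      using edges_at_nonempty[OF x] by (intro Max_in) auto
    then obtain e where e: "e \<in> edges_at E x" "Max (y ` edges_at E x) = y e" by auto
    have "exp (y e) \<le> (\<Sum>f\<in>edges_at E x. exp (y f))"
      using e by (intro member_le_sum) auto
    then have "ln (exp (y e)) \<le> ln (\<Sum>f\<in>edges_at E x. exp (y f))"
      by (intro ln_mono) auto
    then show ?thesis using d e by (intro mult_left_mono_neg) auto
  qed
qed

text \<open>Lowering the top level set \<open>A\<close> of \<open>y\<close> to the next level changes the left-hand side at rate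
  \<open>beta V E (C - A) - c * card (C - A)\<close>; induct on the number of levels.\<close>

lemma star_max_coercive:
  assumes C: "C \<subseteq> E" "C \<noteq> {}" and beta: "beta V E C = c * real (card C)"
    and \<delta>: "\<And>A. A \<noteq> {} \<Longrightarrow> A \<subset> C \<Longrightarrow> \<delta> \<le> beta V E A - c * real (card A)"
    and "0 \<le> \<delta>" and ab: "a \<in> C" "b \<in> C"
  shows "star_max V E C y - c * sum y C \<le> - \<delta> * (y a - y b)"
proof (induction "card (y ` C)" arbitrary: y rule: less_induct)
  case less
  have finC: "finite C" using C finite_E finite_subset by blast
  note fin = finC finite_edges_at finite_inner_vertices
  define M where "M = Max (y ` C)"
  have M: "y e \<le> M" if "e \<in> C" for e using that finC by (simp add: M_def)
  have star: "edges_at E x \<subseteq> C" "edges_at E x \<noteq> {}" if "x \<in> inner_vertices V E C" for x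
    using that edges_at_nonempty by (auto simp: inner_vertices_def)
  have M_in: "M \<in> y ` C" unfolding M_def using finC C by (intro Max_in) auto
  show ?case
  proof (cases "y ` C = {M}")
    case True
    then have y: "y e = M" if "e \<in> C" for e using that by auto
    have "Max (y ` edges_at E x) = M" if "x \<in> inner_vertices V E C" for x
    proof -
      have "y ` edges_at E x = {M}" using star[OF that] y by auto
      then show ?thesis by simp
    qed
    then have "star_max V E C y = beta V E C * M"
      by (simp add: star_max_def beta_def inner_vertices_def sum_distrib_right)
    moreover have "sum y C = M * real (card C)" using y by simp
    ultimately show ?thesis using beta y ab by simp
  next
    case False
    \<comment> \<open>\<open>M'\<close> is the second highest level; truncating there merges the two
      top levels, so \<open>y'\<close> takes fewer values.\<close>
    define M' where "M' = Max (y ` C - {M})"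
    define y' where "y' e = min (y e) M'" for e
    define A where "A = {e\<in>C. y e = M}"
    have M'_in: "M' \<in> y ` C - {M}" unfolding M'_def using finC False M_in by (intro Max_in) auto
    then have lt: "M' < M" using M by force
    have le: "y e \<le> M'" if "e \<in> C - A" for e
      using that finC by (auto simp: M'_def A_def)
    have A: "A \<noteq> {}" "A \<subseteq> C" "A \<noteq> C" using M_in M'_in by (auto simp: A_def)
    have y_eq: "y e = y' e + (if e \<in> A then M - M' else 0)" if "e \<in> C" for e
      using that le[of e] lt by (auto simp: y'_def A_def min_def)
    have "y' ` C \<subseteq> y ` C - {M}"
    proof
      fix z assume "z \<in> y' ` C"
      then obtain e where e: "e \<in> C" "z = y' e" by auto
      show "z \<in> y ` C - {M}"
      proof (cases "e \<in> A")
        case True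
        then have "z = M'" using e lt by (simp add: y'_def A_def)
        then show ?thesis using M'_in by simp
      next
        case False
        then have "z = y e" "y e \<noteq> M" using e le[of e] by (auto simp: y'_def A_def)
        then show ?thesis using e by simp
      qed
    qed
    then have "card (y' ` C) < card (y ` C)"
      using M_in finC by (intro psubset_card_mono) auto
    note IH = less[OF this]
    \<comment> \<open>A star maximum drops by the full gap exactly when the star meets
      \<open>A\<close>, since truncation is monotone and commutes with maxima.\<close>
    have max_eq: "Max (y ` edges_at E x) =
        Max (y' ` edges_at E x) + (if edges_at E x \<inter> A = {} then 0 else M - M')"
      if x: "x \<in> inner_vertices V E C" for x
    proof -
      note st = star[OF x]
      have "mono (\<lambda>t. min t M')" by (auto simp: mono_def min_def)
      then have "min (Max (y ` edges_at E x)) M' = Max ((\<lambda>t. min t M') ` (y ` edges_at E x))"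
        using st fin by (intro mono_Max_commute) auto
      also have "(\<lambda>t. min t M') ` (y ` edges_at E x) = y' ` edges_at E x"
        by (auto simp: y'_def image_image)
      finally have *: "Max (y' ` edges_at E x) = min (Max (y ` edges_at E x)) M'" ..
      show ?thesis
      proof (cases "edges_at E x \<inter> A = {}")
        case True
        then have "Max (y ` edges_at E x) \<le> M'"
          using st le fin by (subst Max_le_iff) auto
        then show ?thesis using * True by simp
      next
        case False
        then obtain e where e: "e \<in> edges_at E x" "y e = M" by (auto simp: A_def)
        then have "Max (y ` edges_at E x) = M"
          using st M fin by (intro Max_eqI) auto
        then show ?thesis using * False lt by simp
      qed
    qed
    have CA: "C - A \<noteq> {}" "C - A \<subset> C" using A by auto
    have "beta V E (C - A) = (\<Sum>x\<in>inner_vertices V E C.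
        if edges_at E x \<inter> A = {} then 2 - real (degree E x) else 0)"
      unfolding beta_eq_sum_inner[OF Diff_subset]
      using star by (intro sum.cong refl) auto
    moreover have "beta V E C = (\<Sum>x\<in>inner_vertices V E C. 2 - real (degree E x))"
      by (simp add: beta_def inner_vertices_def)
    ultimately have \<beta>: "(\<Sum>x\<in>inner_vertices V E C.
        if edges_at E x \<inter> A = {} then 0 else 2 - real (degree E x)) = beta V E C - beta V E (C - A)"
      by (simp add: sum_subtractf[symmetric]) (intro sum.cong, auto)
    have "star_max V E C y = star_max V E C y' + (\<Sum>x\<in>inner_vertices V E C.
        (M - M') * (if edges_at E x \<inter> A = {} then 0 else 2 - real (degree E x)))"
      unfolding star_max_def sum.distrib[symmetric] by (intro sum.cong refl) (simp add: max_eq algebra_simps)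
    then have 1: "star_max V E C y = star_max V E C y' + (M - M') * (beta V E C - beta V E (C - A))"
      unfolding \<beta>[symmetric] sum_distrib_left .
    have "sum y C = (\<Sum>e\<in>C. y' e + (if e \<in> A then M - M' else 0))"
      using y_eq by (intro sum.cong) auto
    also have "\<dots> = sum y' C + (M - M') * real (card A)"
      using A finC by (simp add: sum.distrib sum.If_cases Int_absorb1)
    finally have 2: "sum y C = sum y' C + (M - M') * real (card A)" .
    have "real (card C) = real (card A) + real (card (C - A))"
      using A finC finite_subset by (subst card_Diff_subset) (auto simp: of_nat_diff card_mono)
    \<comment> \<open>The relation \<open>beta V E C = c * card C\<close> converts the contribution
      of \<open>A\<close> into the excess of its complement, to which the bound by \<delta>
      applies.\<close>
    then have "star_max V E C y - c * sum y C =
        (star_max V E C y' - c * sum y' C) - (M - M') * (beta V E (C - A) - c * real (card (C - A)))"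
      unfolding 1 2 beta by (simp add: algebra_simps)
    also have "\<dots> \<le> - \<delta> * (y' a - y' b) - (M - M') * \<delta>"
      using IH \<delta>[OF CA] lt by (intro diff_mono mult_left_mono) auto
    also have "\<dots> \<le> - \<delta> * (y a - y b)"
    proof -
      \<comment> \<open>Truncation lowers each value by zero or by the gap, so a difference shrinks
        by at most one gap.\<close>
      have "y a - y b \<le> y' a - y' b + (M - M')"
        using y_eq[OF ab(1)] y_eq[OF ab(2)] lt by (auto split: if_splits)
      then have "\<delta> * (y a - y b) \<le> \<delta> * (y' a - y' b + (M - M'))"
        using \<open>0 \<le> \<delta>\<close> by (rule mult_left_mono)
      then show ?thesis by (simp add: algebra_simps)
    qed
    finally show ?thesis .
  qed
qed

end

section \<open>Existence and characterization of reduced solutions\<close>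

context nontrivial_tree
begin

text \<open>The curvature is homogeneous of degree zero. This permits normalizing a critical point
  to the simplex and replacing flow weights by shifted logarithms.\<close>

lemma reduced_curvature_scale:
  assumes "r \<noteq> 0" "\<And>f. f \<in> C \<Longrightarrow> p f = r * q f" "e \<in> C"
  shows "reduced_curvature E C p e = reduced_curvature E C q e"
  unfolding reduced_curvature_def
proof (rule sum.cong[OF refl])
  fix x assume "x \<in> {x \<in> e. edges_at E x \<subseteq> C}"
  then have "(\<Sum>f\<in>edges_at E x. 1 / p f) = (\<Sum>f\<in>edges_at E x. 1 / q f) / r"
    unfolding sum_divide_distrib using assms by (intro sum.cong) auto
  then have "p e * (\<Sum>f\<in>edges_at E x. 1 / p f) = q e * (\<Sum>f\<in>edges_at E x. 1 / q f)"
    using assms by simp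
  then show "(2 - real (degree E x)) / (p e * (\<Sum>f\<in>edges_at E x. 1 / p f)) =
    (2 - real (degree E x)) / (q e * (\<Sum>f\<in>edges_at E x. 1 / q f))" by simp
qed

text \<open>A common shift leaves every log-sum-exp as an additive term. If
  \<open>beta V E C = c * card C\<close>, the functional to be maximized is therefore invariant
  under constants.\<close>

lemma star_potential_shift:
  "star_potential V E C (\<lambda>e. y e + s) = star_potential V E C y + s * beta V E C"
proof -
  have "ln (\<Sum>f\<in>edges_at E x. exp (y f + s)) = ln (\<Sum>f\<in>edges_at E x. exp (y f)) + s"
    if "x \<in> inner_vertices V E C" for x
    using sum_exp_pos[OF that, of y]
    by (simp add: exp_add ln_mult flip: sum_distrib_right)
  then show ?thesis
    by (simp add: star_potential_def beta_def inner_vertices_def[symmetric] sum.distrib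
        distrib_left sum_distrib_left mult.commute[of s])
qed

lemma star_potential_cong:
  assumes "\<And>e. e \<in> C \<Longrightarrow> y e = z e"
  shows "star_potential V E C y = star_potential V E C z"
  unfolding star_potential_def inner_vertices_def using assms
  by (intro sum.cong arg_cong2[of _ _ _ _ "(*)"] arg_cong[of _ _ ln] refl) auto

lemma continuous_on_coordinate: "continuous_on S (\<lambda>y :: 'i \<Rightarrow> 'b::topological_space. y i)"
  by (rule continuous_on_subset[OF continuous_on_product_coordinates subset_UNIV])

lemma continuous_on_star_potential: "continuous_on S (star_potential V E C)"
  unfolding star_potential_def
proof (intro continuous_intros continuous_on_coordinate ballI)
  fix x and y :: "'a set \<Rightarrow> real"
  assume "x \<in> inner_vertices V E C"
  then show "(\<Sum>f\<in>edges_at E x. exp (y f)) \<noteq> 0" using sum_exp_pos[of x C y] by simp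
qed

text \<open>Tychonoff: points are functions on the whole index type, with the product
  topology.\<close>

lemma compact_box: "compact {y :: 'i \<Rightarrow> real. \<forall>i. \<bar>y i\<bar> \<le> B}"
proof -
  have "compactin (product_topology (\<lambda>_. euclidean) UNIV) (PiE UNIV (\<lambda>_::'i. {-B..B}))"
    by (subst compactin_PiE) auto
  then have "compact (PiE UNIV (\<lambda>_::'i. {-B..B}))"
    by (simp add: euclidean_product_topology)
  also have "PiE UNIV (\<lambda>_::'i. {-B..B}) = {y. \<forall>i. \<bar>y i\<bar> \<le> B}"
    by (simp add: PiE_UNIV_domain Pi_def abs_le_iff minus_le_iff conj_commute)
  finally show ?thesis .
qed

text \<open>Shift invariance fixes one coordinate at zero, and coercivity puts every competitor
  outside a box below the value at the origin; on the box compactness applies.\<close>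

lemma star_potential_attains_max:
  assumes C: "C \<subseteq> E" "C \<noteq> {}" and beta: "beta V E C = c * real (card C)"
    and less: "\<And>A. A \<noteq> {} \<Longrightarrow> A \<subset> C \<Longrightarrow> c * real (card A) < beta V E A"
  shows "\<exists>y. \<forall>z. star_potential V E C z - c * sum z C \<le> star_potential V E C y - c * sum y C"
proof -
  define F where "F y = star_potential V E C y - c * sum y C" for y
  have finC: "finite C" using C finite_E finite_subset by blast
  obtain a where a: "a \<in> C" using C by auto
  \<comment> \<open>The inserted 1 keeps the minimum defined when \<open>C\<close> is a singleton
    and has no nonempty proper subset.\<close>
  define \<delta> where "\<delta> = Min (insert 1 ((\<lambda>A. beta V E A - c * real (card A)) ` {A. A \<noteq> {} \<and> A \<subset> C}))"
  have fin: "finite {A. A \<noteq> {} \<and> A \<subset> C}"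
    by (rule finite_subset[of _ "Pow C"]) (use finC in auto)
  have \<delta>: "0 < \<delta>" using fin less by (auto simp: \<delta>_def)
  have \<delta>_le: "\<delta> \<le> beta V E A - c * real (card A)" if "A \<noteq> {}" "A \<subset> C" for A
    unfolding \<delta>_def using fin that by (intro Min_le) auto
  have coercive: "F y \<le> - \<delta> * \<bar>y b - y a\<bar>" if "b \<in> C" for y b
  proof -
    have "F y \<le> star_max V E C y - c * sum y C"
      by (simp add: F_def star_potential_le_star_max)
    moreover have "star_max V E C y - c * sum y C \<le> - \<delta> * (y a - y b)"
      "star_max V E C y - c * sum y C \<le> - \<delta> * (y b - y a)"
      using star_max_coercive[OF C beta \<delta>_le less_imp_le[OF \<delta>] a that, of y]
        star_max_coercive[OF C beta \<delta>_le less_imp_le[OF \<delta>] that a, of y] by auto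
    moreover have "\<bar>y b - y a\<bar> = y a - y b \<or> \<bar>y b - y a\<bar> = y b - y a" by linarith
    ultimately show ?thesis by (elim disjE) simp_all
  qed
  have shift: "F (\<lambda>e. y e + s) = F y" for y s
    unfolding F_def star_potential_shift beta by (simp add: sum.distrib algebra_simps)
  have cong: "F y = F z" if "\<And>e. e \<in> C \<Longrightarrow> y e = z e" for y z
    using star_potential_cong[of C y z] sum.cong[of C C y z] that by (simp add: F_def)
  \<comment> \<open>Beyond the radius \<open>B\<close> the coercive bound is at most
    \<open>- \<bar>F 0\<bar>\<close>, hence at most the value at the origin.\<close>
  define B where "B = \<bar>F (\<lambda>_. 0)\<bar> / \<delta>"
  have B: "0 \<le> B" using \<delta> by (simp add: B_def)
  have "continuous_on {y. \<forall>i. \<bar>y i\<bar> \<le> B} F"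
    unfolding F_def
    by (intro continuous_intros continuous_on_star_potential continuous_on_coordinate)
  then obtain y where y: "\<And>z. \<forall>i. \<bar>z i\<bar> \<le> B \<Longrightarrow> F z \<le> F y"
    using continuous_attains_sup[OF compact_box[of B], of F] B by (auto intro: exI[of _ "\<lambda>_. 0"])
  have "F z \<le> F y" for z
  proof (cases "\<forall>b\<in>C. \<bar>z b - z a\<bar> \<le> B")
    case True
    \<comment> \<open>Values off \<open>C\<close> do not affect \<open>F\<close>; setting them to
      zero places the representative in the box.\<close>
    define z' where "z' e = (if e \<in> C then z e - z a else 0)" for e
    have "F z = F z'"
      using shift[of z "- z a"] cong[of "\<lambda>e. z e + - z a" z'] by (simp add: z'_def)
    also have "\<dots> \<le> F y" using True B by (intro y) (auto simp: z'_def)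
    finally show ?thesis .
  next
    case False
    then obtain b where b: "b \<in> C" "B < \<bar>z b - z a\<bar>" by auto
    then have "\<delta> * B \<le> \<delta> * \<bar>z b - z a\<bar>" using \<delta> by (intro mult_left_mono) auto
    then have "F z \<le> - (\<delta> * B)" using coercive[OF b(1), of z] by simp
    also have "\<dots> \<le> F (\<lambda>_. 0)" using \<delta> by (simp add: B_def)
    also have "\<dots> \<le> F y" using B by (intro y) auto
    finally show ?thesis .
  qed
  then show ?thesis by (auto simp: F_def)
qed

text \<open>At a maximizer each partial derivative, which is the reduced curvature minus
  \<open>c\<close>, vanishes. Exponentiating and normalizing gives a point of the simplex.\<close>

lemma reduced_solutions_nonempty:
  assumes C: "C \<subseteq> E" "C \<noteq> {}" and beta: "beta V E C = c * real (card C)"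
    and less: "\<And>A. A \<noteq> {} \<Longrightarrow> A \<subset> C \<Longrightarrow> c * real (card A) < beta V E A"
  shows "reduced_solutions E C c \<noteq> {}"
proof -
  have finC: "finite C" using C finite_E finite_subset by blast
  obtain y where y: "\<And>z. star_potential V E C z - c * sum z C \<le> star_potential V E C y - c * sum y C"
    using star_potential_attains_max[OF C beta less] by blast
  define q where "q e = exp (- y e)" for e
  have crit: "reduced_curvature E C q e = c" if e: "e \<in> C" for e
  proof -
    \<comment> \<open>The variation moves the single coordinate \<open>e\<close>, which isolates the
      curvature of that edge.\<close>
    define Y where "Y t f = y f + (if f = e then t else 0)" for t f
    have "((\<lambda>t. Y t f) has_real_derivative (if f = e then 1 else 0)) (at 0)" for f
      by (cases "f = e") (auto simp: Y_def intro!: derivative_eq_intros)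
    then have "((\<lambda>t. star_potential V E C (Y t) - c * sum (Y t) C) has_real_derivative
        (\<Sum>f\<in>C. reduced_curvature E C (\<lambda>e. exp (- Y 0 e)) f * (if f = e then 1 else 0)) -
        c * (\<Sum>f\<in>C. if f = e then 1 else 0)) (at 0)"
      by (intro DERIV_diff DERIV_cmult DERIV_sum star_potential_has_derivative[OF C(1)])
    moreover have "(\<lambda>e. exp (- Y 0 e)) = q" "Y 0 = y" by (auto simp: Y_def q_def fun_eq_iff)
    ultimately have "((\<lambda>t. star_potential V E C (Y t) - c * sum (Y t) C) has_real_derivative
        reduced_curvature E C q e - c) (at 0)"
      using e finC by (simp add: if_distrib cong: if_cong)
    from DERIV_local_max[OF this, of 1] y show ?thesis using \<open>Y 0 = y\<close> by simp
  qed
  define p where "p = restrict (\<lambda>e. q e / sum q C) C"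
  have S: "0 < sum q C" using finC C by (intro sum_pos) (auto simp: q_def)
  have "reduced_curvature E C p e = c" if "e \<in> C" for e
    using reduced_curvature_scale[of "1 / sum q C" C p q e] crit[OF that] S that by (simp add: p_def)
  moreover have "sum p C = 1"
    using S by (simp add: p_def flip: sum_divide_distrib)
  ultimately have "p \<in> reduced_solutions E C c"
    using S by (auto simp: reduced_solutions_def open_simplex_def p_def q_def)
  then show ?thesis by blast
qed

theorem reduced_solutions_characterization:
  assumes C: "C \<subseteq> E" "C \<noteq> {}" and conn: "graph_connected C (branch_adjacency V E C)"
  shows "reduced_solutions E C (lambda V E C) \<noteq> {} \<longleftrightarrow>
      (\<forall>A. A \<noteq> {} \<and> A \<subset> C \<longrightarrow> lambda V E A > lambda V E C)"
    and "reduced_solutions E C (lambda V E C) \<noteq> {} \<Longrightarrow>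
      \<exists>p. reduced_solutions E C (lambda V E C) = {p}"
proof -
  let ?c = "lambda V E C"
  show "reduced_solutions E C ?c \<noteq> {} \<longleftrightarrow> (\<forall>A. A \<noteq> {} \<and> A \<subset> C \<longrightarrow> lambda V E A > ?c)"
  proof
    assume "reduced_solutions E C ?c \<noteq> {}"
    then obtain p where p: "p \<in> reduced_solutions E C ?c" by blast
    show "\<forall>A. A \<noteq> {} \<and> A \<subset> C \<longrightarrow> lambda V E A > ?c"
    proof (intro allI impI)
      fix A assume A: "A \<noteq> {} \<and> A \<subset> C"
      then obtain x where "crossing V E C A x" using crossing_if_connected[OF conn C(1)] by blast
      then show "lambda V E A > ?c" using lambda_greater_if_solution[OF C(1) p] A by simp
    qed
  next
    assume *: "\<forall>A. A \<noteq> {} \<and> A \<subset> C \<longrightarrow> lambda V E A > ?c"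
    show "reduced_solutions E C ?c \<noteq> {}"
    proof (rule reduced_solutions_nonempty[OF C])
      show "beta V E C = ?c * real (card C)" using lambda_iff_beta(3)[OF C, of ?c] by simp
      show "?c * real (card A) < beta V E A" if "A \<noteq> {}" "A \<subset> C" for A
        using * that lambda_iff_beta(1)[of A ?c] C by auto
    qed
  qed
  show "\<exists>p. reduced_solutions E C ?c = {p}" if "reduced_solutions E C ?c \<noteq> {}"
    using that reduced_solutions_unique[OF C conn] by blast
qed

end

section \<open>Convergence of velocities along concave gradient flows\<close>

lemma affine_le_imp_slope_le:
  fixes a b c d T :: real
  assumes "\<And>t. T < t \<Longrightarrow> a * t + b \<le> c * t + d"
  shows "a \<le> c"
proof (rule ccontr)
  assume "\<not> a \<le> c"
  then have ac: "0 < a - c" by simp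
  define t where "t = max (T + 1) ((d - b) / (a - c) + 1)"
  have "a * t + b \<le> c * t + d" by (rule assms) (simp add: t_def)
  then have "(a - c) * t \<le> d - b" by (simp add: algebra_simps)
  moreover have "(d - b) / (a - c) < t" by (simp add: t_def)
  then have "d - b < (a - c) * t" using ac by (simp add: pos_divide_less_eq mult.commute)
  ultimately show False by simp
qed

text \<open>Completeness supplies a limit along integer times; the same Cauchy bound compares every
  late real time with it.\<close>

lemma real_convergent_at_top_if_Cauchy:
  fixes f :: "real \<Rightarrow> real"
  assumes "\<And>\<epsilon>. 0 < \<epsilon> \<Longrightarrow> \<exists>T. \<forall>s\<ge>T. \<forall>t\<ge>T. \<bar>f s - f t\<bar> \<le> \<epsilon>"
  shows "\<exists>l. (f \<longlongrightarrow> l) at_top"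
proof -
  have "Cauchy (\<lambda>n. f (real n))"
    unfolding Cauchy_def
  proof (intro allI impI)
    fix \<epsilon> :: real assume \<epsilon>: "0 < \<epsilon>"
    then obtain T where T: "\<And>s t. T \<le> s \<Longrightarrow> T \<le> t \<Longrightarrow> \<bar>f s - f t\<bar> \<le> \<epsilon> / 2"
      using assms[of "\<epsilon> / 2"] by auto
    show "\<exists>M. \<forall>m\<ge>M. \<forall>n\<ge>M. dist (f (real m)) (f (real n)) < \<epsilon>"
    proof (intro exI[of _ "nat \<lceil>T\<rceil>"] allI impI)
      fix m n assume "nat \<lceil>T\<rceil> \<le> m" "nat \<lceil>T\<rceil> \<le> n"
      then have "T \<le> real m" "T \<le> real n" by linarith+
      then have "\<bar>f (real m) - f (real n)\<bar> \<le> \<epsilon> / 2" by (rule T)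
      then show "dist (f (real m)) (f (real n)) < \<epsilon>" using \<epsilon> by (simp add: dist_real_def)
    qed
  qed
  then obtain l where l: "(\<lambda>n. f (real n)) \<longlonglongrightarrow> l"
    using Cauchy_convergent convergent_def by blast
  have "(f \<longlongrightarrow> l) at_top"
  proof (rule tendstoI)
    fix \<epsilon> :: real assume \<epsilon>: "0 < \<epsilon>"
    then obtain T where T: "\<And>s t. T \<le> s \<Longrightarrow> T \<le> t \<Longrightarrow> \<bar>f s - f t\<bar> \<le> \<epsilon> / 2"
      using assms[of "\<epsilon> / 2"] by auto
    have "dist (f s) l < \<epsilon>" if s: "T \<le> s" for s
    proof -
      have "\<forall>\<^sub>F n in sequentially. \<bar>f s - f (real n)\<bar> \<le> \<epsilon> / 2"
      proof (rule eventually_sequentiallyI[of "nat \<lceil>T\<rceil>"])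
        fix n assume "nat \<lceil>T\<rceil> \<le> n"
        then have "T \<le> real n" by linarith
        then show "\<bar>f s - f (real n)\<bar> \<le> \<epsilon> / 2" by (rule T[OF s])
      qed
      then have "\<bar>f s - l\<bar> \<le> \<epsilon> / 2"
        by (rule tendsto_upperbound[rotated]) (auto intro!: tendsto_intros l)
      then show ?thesis using \<epsilon> by (simp add: dist_real_def)
    qed
    then show "\<forall>\<^sub>F s in at_top. dist (f s) l < \<epsilon>"
      unfolding eventually_at_top_linorder by blast
  qed
  then show ?thesis ..
qed

text \<open>Gradient ascent of a concave potential, seen along one trajectory: \<open>k t\<close> is
  the gradient at \<open>Y t\<close>, and \<open>tangent\<close> is the supergradient inequality
  between two of its points.\<close>

locale concave_gradient_flow =
  fixes I :: "'i set" and Y k :: "real \<Rightarrow> 'i \<Rightarrow> real" and \<Phi> :: "real \<Rightarrow> real"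
  assumes finite_I: "finite I"
    and Y_deriv: "\<And>t i. 0 < t \<Longrightarrow> i \<in> I \<Longrightarrow> ((\<lambda>s. Y s i) has_real_derivative k t i) (at t)"
    and \<Phi>_deriv: "\<And>t. 0 < t \<Longrightarrow> (\<Phi> has_real_derivative (\<Sum>i\<in>I. (k t i)\<^sup>2)) (at t)"
    and tangent: "\<And>s t. 0 < s \<Longrightarrow> 0 < t \<Longrightarrow> \<Phi> t \<le> \<Phi> s + (\<Sum>i\<in>I. k s i * (Y t i - Y s i))"
begin

definition speed :: "real \<Rightarrow> real" where "speed t = (\<Sum>i\<in>I. (k t i)\<^sup>2)"

text \<open>Add the tangent inequalities taken at the two times.\<close>

lemma gradient_monotone:
  assumes "0 < s" "0 < t"
  shows "(\<Sum>i\<in>I. (Y t i - Y s i) * (k t i - k s i)) \<le> 0"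
proof -
  have "(\<Sum>i\<in>I. (Y t i - Y s i) * (k t i - k s i)) =
      - (\<Sum>i\<in>I. k s i * (Y t i - Y s i)) - (\<Sum>i\<in>I. k t i * (Y s i - Y t i))"
    by (simp add: algebra_simps sum_subtractf sum.distrib)
  then show ?thesis using tangent[OF assms] tangent[OF assms(2,1)] by simp
qed

text \<open>By monotonicity of the gradient the flow is a contraction; comparing it with its own time
  shifts shows that the speed decreases.\<close>

lemma shift_distance_antimono:
  assumes "0 < s" "s \<le> t" "0 < h"
  shows "(\<Sum>i\<in>I. (Y (t + h) i - Y t i)\<^sup>2) \<le> (\<Sum>i\<in>I. (Y (s + h) i - Y s i)\<^sup>2)"
proof (rule DERIV_nonpos_imp_nonincreasing[OF assms(2)])
  fix u assume u: "s \<le> u" "u \<le> t"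
  have sh: "((\<lambda>u. Y (u + h) i) has_real_derivative k (u + h) i) (at u)" if "i \<in> I" for i
    using Y_deriv[of "u + h" i] u assms that by (simp add: DERIV_shift)
  have "((\<lambda>u. \<Sum>i\<in>I. (Y (u + h) i - Y u i)\<^sup>2) has_real_derivative
      (\<Sum>i\<in>I. 2 * ((Y (u + h) i - Y u i) * (k (u + h) i - k u i)))) (at u)"
  proof (rule DERIV_sum)
    fix i assume i: "i \<in> I"
    have "((\<lambda>u. Y u i) has_real_derivative k u i) (at u)" using Y_deriv i u assms by simp
    from DERIV_power[OF DERIV_diff[OF sh[OF i] this], of 2]
    show "((\<lambda>u. (Y (u + h) i - Y u i)\<^sup>2) has_real_derivative
        2 * ((Y (u + h) i - Y u i) * (k (u + h) i - k u i))) (at u)"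
      by (simp add: mult_ac)
  qed
  moreover have "(\<Sum>i\<in>I. 2 * ((Y (u + h) i - Y u i) * (k (u + h) i - k u i))) \<le> 0"
    using gradient_monotone[of u "u + h"] u assms by (simp flip: sum_distrib_left)
  ultimately show "\<exists>y. ((\<lambda>u. \<Sum>i\<in>I. (Y (u + h) i - Y u i)\<^sup>2) has_real_derivative y) (at u) \<and> y \<le> 0"
    by blast
qed

text \<open>Divide the antitone shift distance by the squared shift and let the shift tend to
  zero.\<close>

lemma speed_antimono:
  assumes "0 < s" "s \<le> t"
  shows "speed t \<le> speed s"
proof -
  have lim: "((\<lambda>h. \<Sum>i\<in>I. ((Y (u + h) i - Y u i) / h)\<^sup>2) \<longlongrightarrow> speed u) (at_right 0)" if "0 < u" for u
    unfolding speed_def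
  proof (intro tendsto_intros)
    fix i assume "i \<in> I"
    then have "((\<lambda>h. (Y (u + h) i - Y u i) / h) \<longlongrightarrow> k u i) (at 0)"
      using Y_deriv that by (simp add: DERIV_def)
    then show "((\<lambda>h. (Y (u + h) i - Y u i) / h) \<longlongrightarrow> k u i) (at_right 0)"
      by (rule tendsto_mono[OF at_le, rotated]) simp
  qed
  have "\<forall>\<^sub>F h in at_right 0. (\<Sum>i\<in>I. ((Y (t + h) i - Y t i) / h)\<^sup>2) \<le>
      (\<Sum>i\<in>I. ((Y (s + h) i - Y s i) / h)\<^sup>2)"
    using eventually_at_right_less
  proof eventually_elim
    case (elim h)
    then show ?case
      using shift_distance_antimono[OF assms, of h]
      by (simp add: power_divide divide_right_mono flip: sum_divide_distrib)
  qed
  then show ?thesis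
    using lim assms by (intro tendsto_le[of "at_right 0"]) auto
qed

lemma speed_nonneg: "0 \<le> speed t"
  by (simp add: speed_def sum_nonneg)

definition limit_speed :: real where "limit_speed = Inf (speed ` {0<..})"

lemma limit_speed_le: "0 < t \<Longrightarrow> limit_speed \<le> speed t"
  unfolding limit_speed_def by (rule cInf_lower) (auto intro: bdd_belowI[of _ 0] speed_nonneg)

lemma speed_near_limit:
  assumes "0 < \<epsilon>"
  shows "\<exists>T>0. \<forall>t\<ge>T. speed t < limit_speed + \<epsilon>"
proof -
  have "\<exists>a\<in>speed ` {0<..}. a < limit_speed + \<epsilon>"
    unfolding limit_speed_def using assms
    by (intro cInf_lessD) auto
  then obtain T where "0 < T" "speed T < limit_speed + \<epsilon>" by auto
  then show ?thesis using speed_antimono by (intro exI[of _ T]) force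
qed

text \<open>The mean value theorem is applied to the scalar product of \<open>Y\<close> with the
  displacement itself. Young's inequality then absorbs half of the squared displacement, and the
  speed is antitone.\<close>

lemma displacement_le:
  assumes "0 < s" "s < t"
  shows "(\<Sum>i\<in>I. (Y t i - Y s i)\<^sup>2) \<le> (t - s)\<^sup>2 * speed s"
proof -
  define u where "u i = Y t i - Y s i" for i
  have "\<exists>z>s. z < t \<and> (\<Sum>i\<in>I. u i * Y t i) - (\<Sum>i\<in>I. u i * Y s i) = (t - s) * (\<Sum>i\<in>I. u i * k z i)"
    using assms Y_deriv by (intro MVT2 DERIV_sum DERIV_cmult) auto
  then obtain z where z: "s < z" "z < t"
    "(\<Sum>i\<in>I. u i * Y t i) - (\<Sum>i\<in>I. u i * Y s i) = (t - s) * (\<Sum>i\<in>I. u i * k z i)" by blast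
  have "(\<Sum>i\<in>I. (u i)\<^sup>2) = (\<Sum>i\<in>I. u i * Y t i) - (\<Sum>i\<in>I. u i * Y s i)"
    by (simp add: u_def power2_eq_square right_diff_distrib flip: sum_subtractf)
  also have "\<dots> = (\<Sum>i\<in>I. u i * ((t - s) * k z i))"
    unfolding z by (simp add: sum_distrib_left mult_ac)
  also have "\<dots> \<le> (\<Sum>i\<in>I. ((u i)\<^sup>2 + ((t - s) * k z i)\<^sup>2) / 2)"
  proof (rule sum_mono)
    fix i
    have "0 \<le> (u i - (t - s) * k z i)\<^sup>2" by simp
    then show "u i * ((t - s) * k z i) \<le> ((u i)\<^sup>2 + ((t - s) * k z i)\<^sup>2) / 2"
      by (simp add: power2_diff)
  qed
  also have "\<dots> = ((\<Sum>i\<in>I. (u i)\<^sup>2) + (t - s)\<^sup>2 * speed z) / 2"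
    by (simp add: speed_def sum.distrib sum_distrib_left power_mult_distrib flip: sum_divide_distrib)
  finally have "(\<Sum>i\<in>I. (u i)\<^sup>2) \<le> (t - s)\<^sup>2 * speed z" by simp
  also have "\<dots> \<le> (t - s)\<^sup>2 * speed s"
    using z assms speed_antimono by (intro mult_left_mono) auto
  finally show ?thesis by (simp add: u_def)
qed

text \<open>Expand the square. The potential grows at rate at least \<open>limit_speed\<close>, so
  the tangent inequality bounds the cross term from below; \<open>displacement_le\<close> bounds the
  squared mean velocity by \<open>speed s\<close>.\<close>

lemma velocity_near_mean:
  assumes "0 < s" "s < t"
  shows "(\<Sum>i\<in>I. (k s i - (Y t i - Y s i) / (t - s))\<^sup>2) \<le> 2 * (speed s - limit_speed)"
proof -
  define u where "u i = Y t i - Y s i" for i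
  have "\<exists>z>s. z < t \<and> \<Phi> t - \<Phi> s = (t - s) * speed z"
    unfolding speed_def using assms \<Phi>_deriv by (intro MVT2) auto
  then obtain z where "s < z" "\<Phi> t - \<Phi> s = (t - s) * speed z" by blast
  then have "(t - s) * limit_speed \<le> \<Phi> t - \<Phi> s"
    using limit_speed_le[of z] assms by (simp add: mult_left_mono)
  also have "\<dots> \<le> (\<Sum>i\<in>I. k s i * u i)"
    using tangent[of s t] assms by (simp add: u_def)
  finally have 1: "limit_speed \<le> (\<Sum>i\<in>I. k s i * u i) / (t - s)"
    using assms by (simp add: pos_le_divide_eq mult.commute)
  have 2: "(\<Sum>i\<in>I. (u i)\<^sup>2) / (t - s)\<^sup>2 \<le> speed s"
    using displacement_le[OF assms] assms by (simp add: u_def pos_divide_le_eq mult.commute)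
  have "(\<Sum>i\<in>I. (k s i - u i / (t - s))\<^sup>2) =
      speed s - 2 * ((\<Sum>i\<in>I. k s i * u i) / (t - s)) + (\<Sum>i\<in>I. (u i)\<^sup>2) / (t - s)\<^sup>2"
    by (simp add: power2_diff speed_def sum.distrib sum_subtractf sum_distrib_left
        sum_divide_distrib power_divide mult.assoc)
  then show ?thesis using 1 2 by (simp add: u_def)
qed

text \<open>A late velocity is close to the mean velocity over every later interval. For long
  intervals the means from two starting times agree asymptotically, so late velocities are close to
  each other.\<close>

theorem velocity_converges:
  assumes i: "i \<in> I"
  shows "\<exists>l. ((\<lambda>t. k t i) \<longlongrightarrow> l) at_top"
proof (rule real_convergent_at_top_if_Cauchy)
  fix \<epsilon>' :: real assume "0 < \<epsilon>'"
  define \<epsilon> where "\<epsilon> = \<epsilon>' / 2"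
  have \<epsilon>: "0 < \<epsilon>" using \<open>0 < \<epsilon>'\<close> by (simp add: \<epsilon>_def)
  \<comment> \<open>The margin is chosen so that twice the excess speed in
    \<open>velocity_near_mean\<close> stays below \<open>\<epsilon>\<^sup>2\<close>.\<close>
  then obtain T where T: "0 < T" "\<And>t. T \<le> t \<Longrightarrow> speed t < limit_speed + \<epsilon>\<^sup>2 / 2"
    using speed_near_limit[of "\<epsilon>\<^sup>2 / 2"] by auto
  have near: "\<bar>k s i * (t - s) - (Y t i - Y s i)\<bar> \<le> \<epsilon> * (t - s)" if "T \<le> s" "s < t" for s t
  proof -
    have "(k s i - (Y t i - Y s i) / (t - s))\<^sup>2 \<le> (\<Sum>i\<in>I. (k s i - (Y t i - Y s i) / (t - s))\<^sup>2)"
      using i finite_I by (intro member_le_sum) auto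
    also have "\<dots> \<le> 2 * (speed s - limit_speed)"
      using that T by (intro velocity_near_mean) auto
    also have "\<dots> \<le> \<epsilon>\<^sup>2" using T(2)[OF that(1)] by simp
    finally have "\<bar>k s i - (Y t i - Y s i) / (t - s)\<bar> \<le> \<epsilon>"
      using \<epsilon> by (simp add: abs_le_square_iff[symmetric])
    then have "\<bar>k s i - (Y t i - Y s i) / (t - s)\<bar> * (t - s) \<le> \<epsilon> * (t - s)"
      using that by (intro mult_right_mono) auto
    moreover have "(k s i - (Y t i - Y s i) / (t - s)) * (t - s) = k s i * (t - s) - (Y t i - Y s i)"
      using that by (subst left_diff_distrib) simp
    ultimately show ?thesis using that abs_mult[of "k s i - (Y t i - Y s i) / (t - s)" "t - s"] by simp
  qed
  \<comment> \<open>Both sides become slopes of affine bounds for \<open>Y t i\<close>, one from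
    below and one from above, valid for all large \<open>t\<close>.\<close>
  have le: "k s i - \<epsilon> \<le> k s' i + \<epsilon>" if s: "T \<le> s" "T \<le> s'" for s s'
  proof (rule affine_le_imp_slope_le)
    fix t assume t: "max s s' < t"
    show "(k s i - \<epsilon>) * t + (Y s i - (k s i - \<epsilon>) * s) \<le>
        (k s' i + \<epsilon>) * t + (Y s' i - (k s' i + \<epsilon>) * s')"
      using near[OF s(1), of t] near[OF s(2), of t] t by (simp add: algebra_simps abs_le_iff)
  qed
  show "\<exists>T. \<forall>s\<ge>T. \<forall>t\<ge>T. \<bar>k s i - k t i\<bar> \<le> \<epsilon>'"
  proof (intro exI[of _ T] allI impI)
    fix s t assume "T \<le> s" "T \<le> t"
    then show "\<bar>k s i - k t i\<bar> \<le> \<epsilon>'" using le[of s t] le[of t s] by (simp add: \<epsilon>_def abs_le_iff)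
  qed
qed

end

section \<open>Asymptotics of the normalized flow\<close>

text \<open>Eventually the derivative exceeds \<open>d / 2\<close>, so \<open>g\<close> lies above a
  line of positive slope.\<close>

lemma exp_minus_tendsto_0_if_deriv_tendsto_pos:
  fixes g :: "real \<Rightarrow> real"
  assumes deriv: "\<And>t. 0 < t \<Longrightarrow> (g has_real_derivative g' t) (at t)"
    and lim: "(g' \<longlongrightarrow> d) at_top" and d: "0 < d"
  shows "((\<lambda>t. exp (- g t)) \<longlongrightarrow> 0) at_top"
proof -
  have "\<forall>\<^sub>F t in at_top. d / 2 < g' t"
    using lim d by (intro order_tendstoD) auto
  then obtain T0 where T0: "\<And>t. T0 \<le> t \<Longrightarrow> d / 2 < g' t"
    unfolding eventually_at_top_linorder by auto
  define T where "T = max 1 T0"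
  have le: "(g T - d / 2 * T) + d / 2 * t \<le> g t" if t: "T \<le> t" for t
  proof -
    have "g T - d / 2 * T \<le> g t - d / 2 * t"
    proof (rule DERIV_nonneg_imp_nondecreasing[OF t])
      fix u assume u: "T \<le> u" "u \<le> t"
      then have "(g has_real_derivative g' u) (at u)" by (intro deriv) (auto simp: T_def)
      then have "((\<lambda>u. g u - d / 2 * u) has_real_derivative (g' u - d / 2)) (at u)"
        by (auto intro!: derivative_eq_intros)
      then show "\<exists>y. ((\<lambda>u. g u - d / 2 * u) has_real_derivative y) (at u) \<and> 0 \<le> y"
        using T0[of u] u by (intro exI[of _ "g' u - d / 2"]) (auto simp: T_def)
    qed
    then show ?thesis by simp
  qed
  have "filterlim (\<lambda>t. (g T - d / 2 * T) + d / 2 * t) at_top at_top"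
    by (intro filterlim_tendsto_add_at_top[OF tendsto_const]
        filterlim_tendsto_pos_mult_at_top[OF tendsto_const] filterlim_ident) (use d in simp)
  then have "filterlim g at_top at_top"
    by (rule filterlim_at_top_mono) (use le eventually_at_top_linorder in blast)
  then show ?thesis
    by (intro filterlim_compose[OF exp_at_bot]) (simp add: filterlim_uminus_at_bot)
qed

section \<open>The flow in logarithmic coordinates\<close>

locale tree_flow = nontrivial_tree V E for V :: "'a set" and E :: "'a set set" +
  fixes w :: "real \<Rightarrow> 'a set \<Rightarrow> real"
  assumes flow: "normalized_flow V E w"
begin

definition \<kappa> :: "real \<Rightarrow> 'a set \<Rightarrow> real" where "\<kappa> t e = reduced_curvature E E (w t) e"

text \<open>Centring the negative logarithms removes the mean curvature from the evolution; the
  linear drift restores the constant average of the edge curvatures, so that the velocity is exactly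
  the curvature.\<close>

definition log_coordinate :: "real \<Rightarrow> 'a set \<Rightarrow> real" where
  "log_coordinate t e = (\<Sum>f\<in>E. ln (w t f)) / real (card E) - ln (w t e) + lambda V E E * t"

lemma w_pos: "0 \<le> t \<Longrightarrow> e \<in> E \<Longrightarrow> 0 < w t e"
  using flow by (simp add: normalized_flow_def)

lemma edge_curvature_flow: "0 \<le> t \<Longrightarrow> e \<in> E \<Longrightarrow> edge_curvature V E (w t) e = \<kappa> t e"
  unfolding \<kappa>_def using w_pos by (intro edge_curvature_eq_reduced) auto

lemma card_E_pos: "0 < card E"
  using finite_E edges_nonempty by (simp add: card_gt_0_iff)

lemma no_crossing_edges: "\<not> crossing V E C E x"
  using edges_at_subset by (auto simp: crossing_def)

lemma sum_\<kappa>: "0 \<le> t \<Longrightarrow> (\<Sum>e\<in>E. \<kappa> t e) = beta V E E"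
  unfolding \<kappa>_def using w_pos no_crossing_edges by (intro sum_reduced_curvature_eq_beta) auto

lemma ln_w_deriv:
  assumes t: "0 < t" and e: "e \<in> E"
  shows "((\<lambda>s. ln (w s e)) has_real_derivative mean_curvature V E (w t) - \<kappa> t e) (at t)"
proof -
  have pos: "0 < w t e" using w_pos t e by simp
  have "\<forall>t\<ge>0. \<forall>e\<in>E. ((\<lambda>s. w s e) has_real_derivative
      - w t e * (edge_curvature V E (w t) e - mean_curvature V E (w t))) (at t within {0..})"
    using flow unfolding normalized_flow_def by (elim conjE)
  from this[rule_format, OF less_imp_le[OF t] e]
  have "((\<lambda>s. w s e) has_real_derivative - w t e * (\<kappa> t e - mean_curvature V E (w t))) (at t)"
    unfolding edge_curvature_flow[OF less_imp_le[OF t] e]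
    using t by (simp add: at_within_interior[of t "{0..}"])
  from DERIV_chain2[OF DERIV_ln_divide[OF pos] this] show ?thesis
    using pos by simp
qed

lemma log_coordinate_deriv:
  assumes t: "0 < t" and e: "e \<in> E"
  shows "((\<lambda>s. log_coordinate s e) has_real_derivative \<kappa> t e) (at t)"
proof -
  let ?K = "mean_curvature V E (w t)"
  have "((\<lambda>s. log_coordinate s e) has_real_derivative
      (\<Sum>f\<in>E. ?K - \<kappa> t f) / real (card E) - (?K - \<kappa> t e) + lambda V E E * 1) (at t)"
    unfolding log_coordinate_def using t e
    by (intro DERIV_add DERIV_diff DERIV_cdivide DERIV_sum DERIV_cmult ln_w_deriv DERIV_ident)
  moreover have "(\<Sum>f\<in>E. ?K - \<kappa> t f) / real (card E) = ?K - lambda V E E"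
    using t card_E_pos by (simp add: sum_subtractf sum_\<kappa> lambda_def field_simps)
  ultimately show ?thesis by simp
qed

text \<open>At a fixed time the exponentials are a common positive multiple of the weights, so scale
  invariance applies.\<close>

lemma reduced_curvature_log_coordinate:
  assumes t: "0 < t" and e: "e \<in> E"
  shows "reduced_curvature E E (\<lambda>e. exp (- log_coordinate t e)) e = \<kappa> t e"
  unfolding \<kappa>_def
proof (rule reduced_curvature_scale[OF _ _ e])
  let ?r = "exp (- (\<Sum>f\<in>E. ln (w t f)) / real (card E) - lambda V E E * t)"
  show "?r \<noteq> 0" by simp
  fix f assume "f \<in> E"
  then have "0 < w t f" using w_pos t by simp
  have "- log_coordinate t f =
      (- (\<Sum>f\<in>E. ln (w t f)) / real (card E) - lambda V E E * t) + ln (w t f)"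
    by (simp add: log_coordinate_def)
  then show "exp (- log_coordinate t f) = ?r * w t f"
    using \<open>0 < w t f\<close> by (simp only: exp_add exp_ln)
qed

sublocale concave_gradient_flow E log_coordinate \<kappa> "\<lambda>t. star_potential V E E (log_coordinate t)"
proof
  show "finite E" by (rule finite_E)
  fix t :: real assume t: "0 < t"
  show "((\<lambda>s. log_coordinate s e) has_real_derivative \<kappa> t e) (at t)" if "e \<in> E" for e
    by (rule log_coordinate_deriv[OF t that])
  have "((\<lambda>t. star_potential V E E (log_coordinate t)) has_real_derivative
      (\<Sum>e\<in>E. reduced_curvature E E (\<lambda>e. exp (- log_coordinate t e)) e * \<kappa> t e)) (at t)"
    using t by (intro star_potential_has_derivative log_coordinate_deriv order_refl)
  then show "((\<lambda>t. star_potential V E E (log_coordinate t)) has_real_derivative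
      (\<Sum>e\<in>E. (\<kappa> t e)\<^sup>2)) (at t)"
    using t by (simp add: reduced_curvature_log_coordinate power2_eq_square)
next
  fix s t :: real assume "0 < s"
  then show "star_potential V E E (log_coordinate t) \<le> star_potential V E E (log_coordinate s) +
      (\<Sum>e\<in>E. \<kappa> s e * (log_coordinate t e - log_coordinate s e))"
    using star_potential_le_tangent[OF order_refl, of "log_coordinate t" "log_coordinate s"]
    by (simp add: reduced_curvature_log_coordinate)
qed

text \<open>Existence of the limit is what gives meaning to the \<open>Lim\<close> in
  \<open>limit_curvature\<close>.\<close>

lemma \<kappa>_tendsto:
  assumes e: "e \<in> E"
  shows "((\<lambda>t. \<kappa> t e) \<longlongrightarrow> limit_curvature V E w e) at_top"
proof -
  obtain l where l: "((\<lambda>t. \<kappa> t e) \<longlongrightarrow> l) at_top" using velocity_converges[OF e] by auto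
  have "\<forall>\<^sub>F t in at_top. edge_curvature V E (w t) e = \<kappa> t e"
    using eventually_ge_at_top[of 0] by eventually_elim (rule edge_curvature_flow[OF _ e])
  then have "((\<lambda>t. edge_curvature V E (w t) e) \<longlongrightarrow> l) at_top"
    using l tendsto_cong by fast
  then have "limit_curvature V E w e = l"
    unfolding limit_curvature_def by (intro tendsto_Lim) auto
  then show ?thesis using l by simp
qed

text \<open>The common terms of the log coordinates cancel in a difference, whose derivative tends
  to the positive gap of the limit curvatures.\<close>

lemma ratio_tendsto_0:
  assumes ef: "e \<in> E" "f \<in> E" and less: "limit_curvature V E w e < limit_curvature V E w f"
  shows "((\<lambda>t. w t f / w t e) \<longlongrightarrow> 0) at_top"
proof -
  have "((\<lambda>t. exp (- (log_coordinate t f - log_coordinate t e))) \<longlongrightarrow> 0) at_top"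
  proof (rule exp_minus_tendsto_0_if_deriv_tendsto_pos)
    show "((\<lambda>t. log_coordinate t f - log_coordinate t e) has_real_derivative \<kappa> t f - \<kappa> t e) (at t)"
      if "0 < t" for t
      using that ef by (intro DERIV_diff log_coordinate_deriv)
    show "((\<lambda>t. \<kappa> t f - \<kappa> t e) \<longlongrightarrow> limit_curvature V E w f - limit_curvature V E w e) at_top"
      using ef by (intro tendsto_diff \<kappa>_tendsto)
  qed (use less in simp)
  moreover have "\<forall>\<^sub>F t in at_top. exp (- (log_coordinate t f - log_coordinate t e)) = w t f / w t e"
    using eventually_ge_at_top[of 0]
  proof eventually_elim
    case (elim t)
    then show ?case
      using w_pos[OF elim ef(1)] w_pos[OF elim ef(2)] by (simp add: log_coordinate_def exp_diff)
  qed
  ultimately show ?thesis using tendsto_cong by fast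
qed

text \<open>Keep only the term of \<open>f\<close> in the star sum: a much shorter edge at the same
  vertex takes nearly all of the share.\<close>

lemma share_le_ratio:
  assumes "\<forall>g\<in>E. 0 < p g" "e \<in> edges_at E x" "f \<in> edges_at E x"
  shows "share E p x e \<le> p f / p e"
proof -
  have pos: "0 < p e" "0 < p f" using assms by (auto simp: edges_at_def)
  have "1 / p f \<le> (\<Sum>g\<in>edges_at E x. 1 / p g)"
    using assms finite_edges_at by (intro member_le_sum) (auto simp: edges_at_def less_imp_le)
  then have "p e * (1 / p f) \<le> p e * (\<Sum>g\<in>edges_at E x. 1 / p g)"
    using pos by (intro mult_left_mono) auto
  then have "1 / (p e * (\<Sum>g\<in>edges_at E x. 1 / p g)) \<le> 1 / (p e * (1 / p f))"
    using pos by (intro frac_le) auto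
  then show ?thesis using assms(2) by (simp add: share_def edges_at_def)
qed

lemma share_tendsto_0:
  assumes ratio: "((\<lambda>j. w (\<tau> j) f / w (\<tau> j) e) \<longlongrightarrow> 0) F"
    and \<tau>: "\<forall>\<^sub>F j in F. 0 \<le> \<tau> j"
    and ef: "e \<in> edges_at E x" "f \<in> edges_at E x" and x: "x \<in> V"
  shows "((\<lambda>j. share E (w (\<tau> j)) x e) \<longlongrightarrow> 0) F"
proof (rule tendsto_sandwich[OF _ _ tendsto_const ratio])
  show "\<forall>\<^sub>F j in F. 0 \<le> share E (w (\<tau> j)) x e"
    using \<tau> by eventually_elim (use ef x w_pos in \<open>auto intro!: share_nonneg simp: edges_at_def\<close>)
  show "\<forall>\<^sub>F j in F. share E (w (\<tau> j)) x e \<le> w (\<tau> j) f / w (\<tau> j) e"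
    using \<tau> by eventually_elim (use ef w_pos in \<open>auto intro!: share_le_ratio\<close>)
qed

lemma min_limit_curvature_le: "e \<in> E \<Longrightarrow> min_limit_curvature V E w \<le> limit_curvature V E w e"
  unfolding min_limit_curvature_def using finite_E by (intro Min_le) auto

lemma sum_limit_curvature_tendsto:
  assumes "A \<subseteq> E"
  shows "((\<lambda>t. \<Sum>e\<in>A. \<kappa> t e) \<longlongrightarrow> (\<Sum>e\<in>A. limit_curvature V E w e)) at_top"
  using assms by (intro tendsto_sum \<kappa>_tendsto) auto

text \<open>The summed estimate holds at every time and passes to the limit; each limit curvature is
  at least the minimum.\<close>

lemma min_limit_curvature_le_lambda:
  assumes A: "A \<subseteq> E" "A \<noteq> {}"
  shows "min_limit_curvature V E w \<le> lambda V E A"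
proof -
  have "min_limit_curvature V E w * real (card A) \<le> (\<Sum>e\<in>A. limit_curvature V E w e)"
    using sum_mono[of A "\<lambda>_. min_limit_curvature V E w" "limit_curvature V E w"]
      min_limit_curvature_le A by (auto simp: mult.commute)
  also have "\<dots> \<le> beta V E A"
  proof (rule tendsto_upperbound[OF sum_limit_curvature_tendsto[OF A(1)]])
    show "\<forall>\<^sub>F t in at_top. (\<Sum>e\<in>A. \<kappa> t e) \<le> beta V E A"
      using eventually_ge_at_top[of 0]
    proof eventually_elim
      case (elim t)
      then show ?case
        unfolding \<kappa>_def using A w_pos by (intro sum_reduced_curvature_le_beta) auto
    qed
  qed simp
  finally show ?thesis using lambda_iff_beta(2)[OF A] by simp
qed

section \<open>Edges of minimal limit curvature and the global minimum\<close>

definition slow_edges :: "'a set set" where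
  "slow_edges = {e\<in>E. limit_curvature V E w e = min_limit_curvature V E w}"

lemma slow_edges_subset: "slow_edges \<subseteq> E"
  by (auto simp: slow_edges_def)

lemma slow_edges_nonempty: "slow_edges \<noteq> {}"
proof -
  have "min_limit_curvature V E w \<in> limit_curvature V E w ` E"
    unfolding min_limit_curvature_def using finite_E edges_nonempty by (intro Min_in) auto
  then show ?thesis by (auto simp: slow_edges_def)
qed

lemma ratio_slow_tendsto_0:
  assumes "e \<in> slow_edges" "f \<in> E - slow_edges"
  shows "((\<lambda>t. w t f / w t e) \<longlongrightarrow> 0) at_top"
  using assms min_limit_curvature_le[of f]
  by (intro ratio_tendsto_0) (auto simp: slow_edges_def)

text \<open>An edge outside \<open>slow_edges\<close> becomes infinitely short relative to those inside, so a
  vertex meeting both gives no share to \<open>slow_edges\<close> in the limit.\<close>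

lemma lambda_slow_edges: "lambda V E slow_edges = min_limit_curvature V E w"
proof -
  let ?M = slow_edges
  have "((\<lambda>t. \<Sum>x\<in>inner_vertices V E E. (2 - real (degree E x)) * (\<Sum>e\<in>?M. share E (w t) x e)) \<longlongrightarrow>
      (\<Sum>x\<in>inner_vertices V E E. if edges_at E x \<subseteq> ?M then 2 - real (degree E x) else 0)) at_top"
  proof (rule tendsto_sum)
    fix x assume "x \<in> inner_vertices V E E"
    then have x: "x \<in> V" by (simp add: inner_vertices_def)
    have "((\<lambda>t. \<Sum>e\<in>?M. share E (w t) x e) \<longlongrightarrow> (if edges_at E x \<subseteq> ?M then 1 else 0)) at_top"
    proof (cases "edges_at E x \<subseteq> ?M")
      case True
      have "\<forall>\<^sub>F t in at_top. (\<Sum>e\<in>?M. share E (w t) x e) = 1"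
        using eventually_ge_at_top[of 0]
      proof eventually_elim
        case (elim t)
        then show ?case
          using w_pos x True slow_edges_subset by (intro sum_share_superset) (auto simp: edges_at_def)
      qed
      then show ?thesis using True by (simp add: tendsto_eventually)
    next
      case False
      then obtain f where f: "f \<in> edges_at E x" "f \<notin> ?M" by auto
      have "((\<lambda>t. \<Sum>e\<in>?M. share E (w t) x e) \<longlongrightarrow> (\<Sum>e\<in>?M. 0)) at_top"
      proof (rule tendsto_sum)
        fix e assume e: "e \<in> ?M"
        show "((\<lambda>t. share E (w t) x e) \<longlongrightarrow> 0) at_top"
        proof (cases "x \<in> e")
          case True
          show ?thesis
          proof (rule share_tendsto_0[OF ratio_slow_tendsto_0[OF e] _ _ f(1) x])
            show "f \<in> E - ?M" using f by (auto simp: edges_at_def)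
            show "\<forall>\<^sub>F t in at_top. (0::real) \<le> t" by (rule eventually_ge_at_top)
            show "e \<in> edges_at E x" using e True slow_edges_subset by (auto simp: edges_at_def)
          qed
        qed (simp add: share_def)
      qed
      then show ?thesis using False by simp
    qed
    from tendsto_mult[OF tendsto_const this, of "2 - real (degree E x)"]
    show "((\<lambda>t. (2 - real (degree E x)) * (\<Sum>e\<in>?M. share E (w t) x e)) \<longlongrightarrow>
        (if edges_at E x \<subseteq> ?M then 2 - real (degree E x) else 0)) at_top"
      by (simp split: if_splits)
  qed
  then have "((\<lambda>t. \<Sum>e\<in>?M. \<kappa> t e) \<longlongrightarrow> beta V E ?M) at_top"
    unfolding \<kappa>_def sum_reduced_curvature[OF slow_edges_subset]
      beta_eq_sum_inner[OF slow_edges_subset] .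
  then have "beta V E ?M = (\<Sum>e\<in>?M. limit_curvature V E w e)"
    using sum_limit_curvature_tendsto[OF slow_edges_subset] by (intro tendsto_unique) auto
  also have "\<dots> = (\<Sum>e\<in>?M. min_limit_curvature V E w)"
    by (intro sum.cong) (auto simp: slow_edges_def)
  finally show ?thesis
    using lambda_iff_beta(3)[OF slow_edges_subset slow_edges_nonempty] by (simp add: mult.commute)
qed

lemma lambda_min_eq: "lambda_min V E = min_limit_curvature V E w"
  unfolding lambda_min_def
proof (rule Min_eqI)
  have "finite {A. A \<noteq> {} \<and> A \<subseteq> E}"
    by (rule finite_subset[of _ "Pow E"]) (use finite_E in auto)
  then show "finite (lambda V E ` {A. A \<noteq> {} \<and> A \<subseteq> E})" by simp
  show "min_limit_curvature V E w \<in> lambda V E ` {A. A \<noteq> {} \<and> A \<subseteq> E}"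
    using lambda_slow_edges slow_edges_subset slow_edges_nonempty by (intro image_eqI[of _ _ slow_edges]) auto
qed (use min_limit_curvature_le_lambda in auto)

lemma lambda_minimizers_iff:
  "A \<in> lambda_minimizers V E \<longleftrightarrow>
    A \<noteq> {} \<and> A \<subseteq> E \<and> beta V E A = min_limit_curvature V E w * real (card A)"
  unfolding lambda_minimizers_def lambda_min_eq using lambda_iff_beta(3)[of A] by auto

lemma positive_support_subset: "positive_support E q \<subseteq> E"
  by (auto simp: positive_support_def)

text \<open>An edge of larger limit curvature is negligible against a slow one, whose weight
  converges along the sequence; its own weight therefore tends to zero.\<close>

lemma omega_limit_support_slow:
  assumes "omega_limit_point E w q"
  shows "positive_support E q \<subseteq> slow_edges"
proof
  fix e assume e: "e \<in> positive_support E q"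
  then have eE: "e \<in> E" "0 < q e" by (auto simp: positive_support_def)
  obtain \<tau> :: "nat \<Rightarrow> real" where \<tau>: "filterlim \<tau> at_top sequentially"
    and lim: "\<And>e. e \<in> E \<Longrightarrow> (\<lambda>j. w (\<tau> j) e) \<longlonglongrightarrow> q e"
    using assms by (auto simp: omega_limit_point_def)
  show "e \<in> slow_edges"
  proof (rule ccontr)
    assume "e \<notin> slow_edges"
    obtain f where f: "f \<in> slow_edges" using slow_edges_nonempty by auto
    have "((\<lambda>t. w t e / w t f) \<longlongrightarrow> 0) at_top"
      using ratio_slow_tendsto_0[OF f] eE \<open>e \<notin> slow_edges\<close> by auto
    then have "(\<lambda>j. w (\<tau> j) e / w (\<tau> j) f) \<longlonglongrightarrow> 0"
      using filterlim_compose[OF _ \<tau>] by fast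
    moreover have "(\<lambda>j. w (\<tau> j) f) \<longlonglongrightarrow> q f" using lim f slow_edges_subset by auto
    ultimately have "(\<lambda>j. w (\<tau> j) e / w (\<tau> j) f * w (\<tau> j) f) \<longlonglongrightarrow> 0 * q f"
      by (rule tendsto_mult)
    moreover have "\<forall>\<^sub>F j in sequentially. w (\<tau> j) e / w (\<tau> j) f * w (\<tau> j) f = w (\<tau> j) e"
    proof -
      have "\<forall>\<^sub>F j in sequentially. 0 \<le> \<tau> j"
        using \<tau> by (simp add: filterlim_at_top)
      then show ?thesis
      proof eventually_elim
        case (elim j)
        then show ?case using w_pos[of "\<tau> j" f] f slow_edges_subset by auto
      qed
    qed
    ultimately have "(\<lambda>j. w (\<tau> j) e) \<longlonglongrightarrow> 0"
      using tendsto_cong by fastforce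
    then have "q e = 0" using lim[OF eE(1)] LIMSEQ_unique by blast
    then show False using eE by simp
  qed
qed

text \<open>Pass to the limit vertex by vertex. If the star lies in the support, shares converge.
  Otherwise some edge of the star shrinks to zero and takes the share away from \<open>e\<close>, so
  only the terms of the reduced curvature on the support survive.\<close>

lemma omega_limit_reduced_curvature:
  assumes \<omega>: "omega_limit_point E w q" and e: "e \<in> positive_support E q"
  shows "reduced_curvature E (positive_support E q) q e = min_limit_curvature V E w"
proof -
  let ?C = "positive_support E q"
  have eE: "e \<in> E" "0 < q e" using e by (auto simp: positive_support_def)
  obtain \<tau> :: "nat \<Rightarrow> real" where \<tau>: "filterlim \<tau> at_top sequentially"
    and lim: "\<And>e. e \<in> E \<Longrightarrow> (\<lambda>j. w (\<tau> j) e) \<longlonglongrightarrow> q e" and q: "\<And>e. e \<in> E \<Longrightarrow> 0 \<le> q e"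
    using \<omega> by (auto simp: omega_limit_point_def)
  have \<tau>0: "\<forall>\<^sub>F j in sequentially. 0 \<le> \<tau> j"
    using \<tau> by (simp add: filterlim_at_top)
  have "(\<lambda>j. \<Sum>x\<in>inner_vertices V E E. (2 - real (degree E x)) * share E (w (\<tau> j)) x e) \<longlonglongrightarrow>
      (\<Sum>x\<in>inner_vertices V E E. (2 - real (degree E x)) *
        (if x \<in> inner_vertices V E ?C then share E q x e else 0))"
  proof (intro tendsto_sum tendsto_mult tendsto_const)
    fix x assume "x \<in> inner_vertices V E E"
    then have x: "x \<in> V" by (simp add: inner_vertices_def)
    show "(\<lambda>j. share E (w (\<tau> j)) x e) \<longlonglongrightarrow> (if x \<in> inner_vertices V E ?C then share E q x e else 0)"
    proof (cases "x \<in> e")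
      case True
      then have ex: "e \<in> edges_at E x" using eE by (simp add: edges_at_def)
      show ?thesis
      proof (cases "edges_at E x \<subseteq> ?C")
        case sub: True
        then have qx: "\<forall>f\<in>edges_at E x. 0 < q f" by (auto simp: positive_support_def)
        have "(\<lambda>j. 1 / (w (\<tau> j) e * (\<Sum>f\<in>edges_at E x. 1 / w (\<tau> j) f))) \<longlonglongrightarrow>
            1 / (q e * (\<Sum>f\<in>edges_at E x. 1 / q f))"
          using qx eE sum_inverse_pos[OF x qx]
          by (intro tendsto_intros lim) (auto simp: edges_at_def)
        then show ?thesis using True sub x by (simp add: share_def inner_vertices_def)
      next
        case False
        then obtain f where f: "f \<in> edges_at E x" "f \<notin> ?C" by auto
        then have fE: "f \<in> E" by (simp add: edges_at_def)
        then have "q f = 0" using q[of f] f by (auto simp: positive_support_def)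
        have "(\<lambda>j. w (\<tau> j) f / w (\<tau> j) e) \<longlonglongrightarrow> q f / q e"
          using lim fE eE by (intro tendsto_divide) auto
        then have "(\<lambda>j. share E (w (\<tau> j)) x e) \<longlonglongrightarrow> 0"
          using \<open>q f = 0\<close> \<tau>0 ex f(1) x by (intro share_tendsto_0[of \<tau> f e]) auto
        then show ?thesis using False by (simp add: inner_vertices_def)
      qed
    qed (simp add: share_def)
  qed
  also have "(\<Sum>x\<in>inner_vertices V E E. (2 - real (degree E x)) *
        (if x \<in> inner_vertices V E ?C then share E q x e else 0)) =
      (\<Sum>x\<in>inner_vertices V E ?C. (2 - real (degree E x)) * share E q x e)"
    using positive_support_subset[of q] finite_inner_vertices
    by (intro sum.mono_neutral_cong_right) (auto simp: inner_vertices_def)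
  finally have "(\<lambda>j. \<kappa> (\<tau> j) e) \<longlonglongrightarrow> reduced_curvature E ?C q e"
    by (simp add: \<kappa>_def reduced_curvature_eq_sum_share[OF eE(1)])
  moreover have "(\<lambda>j. \<kappa> (\<tau> j) e) \<longlonglongrightarrow> limit_curvature V E w e"
    using filterlim_compose[OF \<kappa>_tendsto[OF eE(1)] \<tau>] .
  ultimately have "reduced_curvature E ?C q e = limit_curvature V E w e"
    by (rule LIMSEQ_unique)
  also have "\<dots> = min_limit_curvature V E w"
    using omega_limit_support_slow[OF \<omega>] e by (auto simp: slow_edges_def)
  finally show ?thesis .
qed

section \<open>The support of an omega-limit point and its components\<close>

context
  fixes q C
  assumes \<omega>: "omega_limit_point E w q" and C: "C = positive_support E q"
begin

lemma support_subset: "C \<subseteq> E"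
  by (auto simp: C positive_support_def)

lemma support_nonempty: "C \<noteq> {}"
proof
  assume "C = {}"
  then have "q e = 0" if "e \<in> E" for e
    using \<omega> that unfolding C positive_support_def omega_limit_point_def by force
  then show False using \<omega> by (simp add: omega_limit_point_def)
qed

lemma sum_support_curvature:
  assumes "A \<subseteq> C"
  shows "(\<Sum>e\<in>A. reduced_curvature E C q e) = min_limit_curvature V E w * real (card A)"
  using assms omega_limit_reduced_curvature[OF \<omega>, folded C] by (simp add: subset_iff)

lemma support_pos: "\<forall>e\<in>C. 0 < q e"
  by (auto simp: C positive_support_def)

text \<open>The reduced curvature is the constant minimum on \<open>C\<close>, so equality in the
  summed estimate says exactly that \<open>A\<close> attains it.\<close>

lemma minimizer_if_no_crossing:
  assumes "A \<subseteq> C" "A \<noteq> {}" "\<nexists>x. crossing V E C A x"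
  shows "A \<in> lambda_minimizers V E"
  unfolding lambda_minimizers_iff
  using sum_reduced_curvature_eq_beta[OF assms(1) support_subset support_pos assms(3)]
    sum_support_curvature[OF assms(1)] assms(1,2) support_subset by simp

lemma not_minimizer_if_crossing:
  assumes "A \<subseteq> C" "crossing V E C A x"
  shows "A \<notin> lambda_minimizers V E"
  unfolding lambda_minimizers_iff
  using sum_reduced_curvature_less_beta[OF assms(1) support_subset support_pos assms(2)]
    sum_support_curvature[OF assms(1)] by simp

lemma support_minimizer: "C \<in> lambda_minimizers V E"
  using support_nonempty by (intro minimizer_if_no_crossing) (auto simp: crossing_def inner_vertices_def)

lemma component_minimizer:
  assumes "D \<in> graph_components C (branch_adjacency V E C)"
  shows "D \<in> lambda_minimizers V E"
proof -
  let ?B = "branch_adjacency V E C"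
  obtain a where a: "a \<in> C" "D = {y\<in>C. \<exists>xs. walk_betw C ?B a xs y}"
    using assms by (auto simp: graph_components_def)
  have "a \<in> D" using a walk_betw_refl[of a C] by auto
  \<comment> \<open>The star of a branch vertex inside \<open>C\<close> is a clique of the adjacency
    graph, so a component cannot split it.\<close>
  moreover have "\<not> crossing V E C D x" for x
  proof
    assume x: "crossing V E C D x"
    then obtain e f where ef: "e \<in> edges_at E x" "e \<in> D" "f \<in> edges_at E x" "f \<notin> D"
      by (auto simp: crossing_def)
    then obtain xs where xs: "walk_betw C ?B a xs e" using a by auto
    have fC: "f \<in> C" and eC: "e \<in> C" using x ef by (auto simp: crossing_def inner_vertices_def)
    have "{e, f} \<in> ?B"
      unfolding branch_adjacency_def using x ef eC fC
      by (auto simp: crossing_def inner_vertices_def edges_at_def)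
    then have "walk_betw C ?B a (xs @ [f]) f" using xs fC by (intro walk_betw_snoc)
    then show False using a ef fC by auto
  qed
  ultimately show ?thesis using a by (intro minimizer_if_no_crossing) auto
qed

text \<open>A nonempty proper part of a component is entered or left by a walk from the base point,
  and the resulting crossing vertex makes the summed estimate strict.\<close>

lemma component_minimal:
  assumes D: "D \<in> graph_components C (branch_adjacency V E C)" and A: "A \<subset> D"
  shows "A \<notin> lambda_minimizers V E"
proof (cases "A = {}")
  case False
  let ?B = "branch_adjacency V E C"
  obtain a where a: "a \<in> C" "D = {y\<in>C. \<exists>xs. walk_betw C ?B a xs y}"
    using D by (auto simp: graph_components_def)
  obtain b c where bc: "b \<in> A" "c \<in> D" "c \<notin> A" "b \<in> D" using A False by auto
  then obtain xs ys where xs: "walk_betw C ?B a xs b" and ys: "walk_betw C ?B a ys c" using a by auto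
  have AC: "A \<subseteq> C" using A a by auto
  have "\<exists>x. crossing V E C A x"
  proof (cases "a \<in> A")
    case True
    then show ?thesis using crossing_if_walk_leaves[OF support_subset ys] bc by auto
  next
    case False
    \<comment> \<open>Here the walk starts outside \<open>A\<close>, so it leaves the complement;
      splitting a star is symmetric in \<open>A\<close> and its complement.\<close>
    then obtain x where "crossing V E C (- A) x"
      using crossing_if_walk_leaves[OF support_subset xs, of "- A"] bc by auto
    then have "crossing V E C A x" by (auto simp: crossing_def)
    then show ?thesis ..
  qed
  then show ?thesis using not_minimizer_if_crossing[OF AC] by auto
qed (simp add: lambda_minimizers_def)

end

end

theorem theorem1p6:
  fixes V :: "'a set" and E :: "'a set set"
  assumes "finite_tree V E" and "E \<noteq> {}"
  shows
    "(\<forall>C. C \<subseteq> E \<and> C \<noteq> {} \<and> graph_connected C (branch_adjacency V E C) \<longrightarrow>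
        (reduced_solutions E C (lambda V E C) \<noteq> {} \<longleftrightarrow>
           (\<forall>A. A \<noteq> {} \<and> A \<subset> C \<longrightarrow> lambda V E A > lambda V E C)) \<and>
        (reduced_solutions E C (lambda V E C) \<noteq> {} \<longrightarrow>
           (\<exists>p. reduced_solutions E C (lambda V E C) = {p}))) \<and>
     (\<forall>w q C. normalized_flow V E w \<and> omega_limit_point E w q \<and> C = positive_support E q \<longrightarrow>
        lambda_min V E = min_limit_curvature V E w \<and>
        C \<in> lambda_minimizers V E \<and>
        (\<forall>D \<in> graph_components C (branch_adjacency V E C).
           D \<in> lambda_minimizers V E \<and>
           (\<forall>A. A \<subset> D \<longrightarrow> A \<notin> lambda_minimizers V E)))"
proof -
  interpret nontrivial_tree V E using assms by unfold_locales
  show ?thesis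
  proof (intro conjI allI impI ballI; (elim conjE)?)
    fix C assume C: "C \<subseteq> E" "C \<noteq> {}" "graph_connected C (branch_adjacency V E C)"
    show "reduced_solutions E C (lambda V E C) \<noteq> {} \<longleftrightarrow>
        (\<forall>A. A \<noteq> {} \<and> A \<subset> C \<longrightarrow> lambda V E A > lambda V E C)"
      by (rule reduced_solutions_characterization(1)[OF C])
    show "\<exists>p. reduced_solutions E C (lambda V E C) = {p}"
      if "reduced_solutions E C (lambda V E C) \<noteq> {}"
      using that by (rule reduced_solutions_characterization(2)[OF C])
  next
    fix w q C assume "normalized_flow V E w" and \<omega>: "omega_limit_point E w q" "C = positive_support E q"
    then interpret tree_flow V E w by unfold_locales
    show "lambda_min V E = min_limit_curvature V E w" by (rule lambda_min_eq)
    show "C \<in> lambda_minimizers V E" by (rule support_minimizer[OF \<omega>])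
    fix D assume D: "D \<in> graph_components C (branch_adjacency V E C)"
    show "D \<in> lambda_minimizers V E" by (rule component_minimizer[OF \<omega> D])
    show "A \<notin> lambda_minimizers V E" if "A \<subset> D" for A
      using that by (rule component_minimal[OF \<omega> D])
  qed
qed

end
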